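(* Let $p$ be a prime and let $R$ be an integral domain with a $p$-Frobenius lift $\phi$. Let $m \leq n$ and let $f_1, \ldots, f_m \in R[[x_1^{\pm1},\ldots,x_n^{\pm1}]]$ be formal Laurent series, each with constant term equal to $1$ and with $\operatorname{supp}(f_j) \subseteq C$ for a common proper cone $C$. Then the Laurent series \[ F = \det\left(\frac{\theta_i f_j}{f_j}\right)_{i,j=1,\ldots,m},\qquad \theta_i = x_i\frac{\partial}{\partial x_i}, \] satisfies the Gauss congruences for $p$ (with respect to $\phi$).
   Context: An integral domain $R$ of characteristic $0$ has a $p$-Frobenius lift $\phi$ if $(p)=pR$ is a prime ideal of $R$ and $\phi:R\to R$ is a ring homomorphism with $\phi(a)\equiv a^p \pmod{pR}$ for all $a\in R$. A cone is the $\mathbb{R}_{\ge0}$-span of a set of vectors in $\mathbb{R}^n$; it is proper if there is a linear form $\alpha$ with $\alpha(\boldsymbol{w})>0$ for all nonzero $\boldsymbol{w}$ in the cone. $R[[\boldsymbol{x}^{\pm1}]]$ denotes formal sums $\sum_{\boldsymbol{k}\in\mathbb{Z}^n} f_{\boldsymbol{k}}\boldsymbol{x}^{\boldsymbol{k}}$ with $f_{\boldsymbol{k}}\in R$; the support $\operatorname{supp}(f)$ is the set of $\boldsymbol{k}$ with $f_{\boldsymbol{k}}\neq0$ and the constant term is $f_{\boldsymbol{0}}$. Series supported on a fixed proper cone $C$ form a ring in which series with constant term $1$ are invertible, so $\theta_i f_j/f_j$ is a well-defined series supported on $C$. A series $f=\sum f_{\boldsymbol{k}}\boldsymbol{x}^{\boldsymbol{k}}\in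 R[[\boldsymbol{x}^{\pm1}]]$ satisfies the Gauss congruences for $p$ (with respect to $\phi$) if $f_{\boldsymbol{m}p^r}\equiv \phi(f_{\boldsymbol{m}p^{r-1}}) \pmod{p^rR}$ for all $\boldsymbol{m}\in\mathbb{Z}^n$ and all $r\ge1$.
   Formalization: The cone C is also assumed to be such that each exponent has only finitely many decompositions into two lattice points of C, so that products of series supported on C exist; this can fail for proper cones spanned by infinite sets but holds for finitely generated or closed ones. *)

theory Defs
  imports
    "HOL-Analysis.Analysis"
    "HOL-Computational_Algebra.Primes"
    "HOL-Algebra.Ring"
begin

text \<open>
  In a domain of characteristic 0 the ideal \<open>(p)\<close> is nonzero, so it is a prime ideal
  precisely when \<open>p\<close> is a prime element; and \<open>a\<close>, \<open>b\<close> are congruent modulo \<open>cR\<close> iff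
  \<open>c dvd a - b\<close>.
\<close>

definition ring_endo :: "('a::comm_ring_1 \<Rightarrow> 'a) \<Rightarrow> bool" where
  "ring_endo \<phi> \<longleftrightarrow> \<phi> 1 = 1 \<and> (\<forall>a b. \<phi> (a + b) = \<phi> a + \<phi> b) \<and> (\<forall>a b. \<phi> (a * b) = \<phi> a * \<phi> b)"

definition frobenius_lift :: "nat \<Rightarrow> ('a::{idom,ring_char_0} \<Rightarrow> 'a) \<Rightarrow> bool" where
  "frobenius_lift p \<phi> \<longleftrightarrow>
     prime_elem (of_nat p :: 'a) \<and> ring_endo \<phi> \<and> (\<forall>a. of_nat p dvd \<phi> a - a ^ p)"


subsection \<open>Cones\<close>

text \<open>
  The \<open>\<real>\<^sub>\<ge>\<^sub>0\<close>-span of a set \<open>S\<close> of vectors is \<^term>\<open>convex_cone hull S\<close> (the span of the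
  empty set being \<open>{0}\<close>).
\<close>

definition proper_cone :: "(real ^ 'n) set \<Rightarrow> bool" where
  "proper_cone C \<longleftrightarrow> (\<exists>\<alpha> :: real ^ 'n \<Rightarrow> real. linear \<alpha> \<and> (\<forall>w\<in>C. w \<noteq> 0 \<longrightarrow> \<alpha> w > 0))"

definition real_vec :: "int ^ 'n \<Rightarrow> real ^ 'n" where
  "real_vec k = (\<chi> i. real_of_int (k $ i))"

text \<open>
  All products of series supported on \<open>C\<close> are defined iff every exponent has only finitely many
  decompositions into two lattice points of \<open>C\<close>. This is automatic for proper cones that are
  finitely generated or closed (see the two lemmas below), but not for the span of an arbitrary
  set: the proper cone \<open>{(x, y). x > 0} \<union> {0}\<close> contains all \<open>(1, k)\<close>, and
  \<open>(2, 0) = (1, k) + (1, -k)\<close>.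
\<close>

definition finite_decompositions :: "(real ^ 'n) set \<Rightarrow> bool" where
  "finite_decompositions C \<longleftrightarrow> (\<forall>k. finite {a. real_vec a \<in> C \<and> real_vec (k - a) \<in> C})"

lemma finite_lattice_cball: "finite {a :: int ^ 'n. norm (real_vec a) \<le> B}"
proof -
  let ?D = "{x :: int. \<bar>real_of_int x\<bar> \<le> B}"
  have "?D \<subseteq> {- \<lceil>B\<rceil> .. \<lceil>B\<rceil>}"
    by (auto simp: abs_le_iff) linarith+
  then have fin: "finite ?D"
    by (rule finite_subset) simp
  have "{a :: int ^ 'n. norm (real_vec a) \<le> B} \<subseteq> vec_lambda ` (PiE UNIV (\<lambda>_. ?D))"
  proof
    fix a :: "int ^ 'n" assume "a \<in> {a. norm (real_vec a) \<le> B}"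
    then have "\<bar>real_of_int (a $ i)\<bar> \<le> B" for i
      using component_le_norm_cart[of "real_vec a" i] by (simp add: real_vec_def)
    then have "vec_nth a \<in> PiE UNIV (\<lambda>_. ?D)" by auto
    then show "a \<in> vec_lambda ` (PiE UNIV (\<lambda>_. ?D))"
      by (metis image_eqI vec_nth_inverse)
  qed
  moreover have "finite (PiE (UNIV :: 'n set) (\<lambda>_. ?D))"
    using fin by (intro finite_PiE) auto
  ultimately show ?thesis
    by (meson finite_imageI finite_subset)
qed

lemma finite_decompositionsI:
  fixes C :: "(real ^ 'n) set"
  assumes lin: "linear \<alpha>" and M: "M \<ge> 0" and le: "\<And>w. w \<in> C \<Longrightarrow> norm w \<le> M * \<alpha> w"
    and nonneg: "\<And>w. w \<in> C \<Longrightarrow> 0 \<le> \<alpha> w"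
  shows "finite_decompositions C"
  unfolding finite_decompositions_def
proof
  fix k :: "int ^ 'n"
  have "norm (real_vec a) \<le> M * \<alpha> (real_vec k)"
    if "real_vec a \<in> C" "real_vec (k - a) \<in> C" for a
  proof -
    have "real_vec (k - a) = real_vec k - real_vec a"
      by (simp add: real_vec_def vec_eq_iff)
    then have "\<alpha> (real_vec (k - a)) = \<alpha> (real_vec k) - \<alpha> (real_vec a)"
      using lin by (simp add: linear_diff)
    with nonneg[OF that(2)] have "\<alpha> (real_vec a) \<le> \<alpha> (real_vec k)" by simp
    then show ?thesis
      using le[OF that(1)] M by (meson mult_left_mono order_trans)
  qed
  then show "finite {a. real_vec a \<in> C \<and> real_vec (k - a) \<in> C}"
    by (intro finite_subset[OF _ finite_lattice_cball[of "M * \<alpha> (real_vec k)"]]) auto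
qed

lemma finite_decompositions_finitely_generated:
  fixes S :: "(real ^ 'n) set"
  assumes fin: "finite S" and "proper_cone (convex_cone hull S)"
  shows "finite_decompositions (convex_cone hull S)"
proof -
  obtain \<alpha> :: "real ^ 'n \<Rightarrow> real" where lin: "linear \<alpha>"
    and pos: "\<And>w. w \<in> convex_cone hull S \<Longrightarrow> w \<noteq> 0 \<Longrightarrow> \<alpha> w > 0"
    using assms(2) unfolding proper_cone_def by blast
  define M where "M = (\<Sum>v\<in>S. norm v / \<alpha> v)"
  have nn: "norm v / \<alpha> v \<ge> 0" if "v \<in> S" for v
    using pos[of v] that by (cases "v = 0") (auto simp: hull_inc less_imp_le)
  have M: "M \<ge> 0" unfolding M_def using nn by (rule sum_nonneg)
  let ?H = "{w. norm w \<le> M * \<alpha> w}"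
  have S: "S \<subseteq> ?H"
  proof
    fix v assume v: "v \<in> S"
    show "v \<in> ?H"
    proof (cases "v = 0")
      case True then show ?thesis using lin by (simp add: linear_0)
    next
      case False
      then have "\<alpha> v > 0" using pos v hull_inc by metis
      moreover have "norm v / \<alpha> v \<le> M"
        unfolding M_def using fin v nn by (intro member_le_sum) auto
      ultimately show ?thesis by (simp add: divide_le_eq)
    qed
  qed
  have "convex_cone ?H"
    unfolding convex_cone_iff
  proof (intro conjI ballI allI impI)
    show "0 \<in> ?H" using lin by (simp add: linear_0)
  next
    fix x y assume "x \<in> ?H" "y \<in> ?H"
    then show "x + y \<in> ?H"
      using lin norm_triangle_ineq[of x y] by (simp add: linear_add distrib_left)
  next
    fix x and c :: real assume "x \<in> ?H" "0 \<le> c"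
    then have "c * norm x \<le> c * (M * \<alpha> x)" by (simp add: mult_left_mono)
    then show "c *\<^sub>R x \<in> ?H"
      using lin \<open>0 \<le> c\<close> by (simp add: linear_cmul mult.left_commute)
  qed
  with S have "convex_cone hull S \<subseteq> ?H" by (rule hull_minimal)
  moreover have "0 \<le> \<alpha> w" if "w \<in> convex_cone hull S" for w
    using pos[OF that] lin by (cases "w = 0") (auto simp: linear_0 less_imp_le)
  ultimately show ?thesis
    using finite_decompositionsI[OF lin M] by blast
qed

lemma finite_decompositions_closed:
  fixes S :: "(real ^ 'n) set"
  assumes "closed (convex_cone hull S)" and "proper_cone (convex_cone hull S)"
  shows "finite_decompositions (convex_cone hull S)"
proof -
  let ?C = "convex_cone hull S"
  obtain \<alpha> :: "real ^ 'n \<Rightarrow> real" where lin: "linear \<alpha>"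
    and pos: "\<And>w. w \<in> ?C \<Longrightarrow> w \<noteq> 0 \<Longrightarrow> \<alpha> w > 0"
    using assms(2) unfolding proper_cone_def by blast
  have nonneg: "0 \<le> \<alpha> w" if "w \<in> ?C" for w
    using pos[OF that] lin by (cases "w = 0") (auto simp: linear_0 less_imp_le)
  have cpt: "compact (?C \<inter> sphere 0 1)"
    using assms(1) by (intro closed_Int_compact) auto
  have cont: "continuous_on (?C \<inter> sphere 0 1) \<alpha>"
    using lin by (simp add: linear_continuous_on linear_conv_bounded_linear)
  obtain c where c: "c > 0" "\<And>w. w \<in> ?C \<inter> sphere 0 1 \<Longrightarrow> c \<le> \<alpha> w"
  proof (cases "?C \<inter> sphere 0 1 = {}")
    case True then show ?thesis using that[of 1] by auto
  next
    case False
    from continuous_attains_inf[OF cpt this cont]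
    obtain x where x: "x \<in> ?C \<inter> sphere 0 1" "\<forall>y\<in>?C \<inter> sphere 0 1. \<alpha> x \<le> \<alpha> y" by blast
    moreover have "\<alpha> x > 0" using x pos[of x] by force
    ultimately show ?thesis using that[of "\<alpha> x"] by blast
  qed
  have "norm w \<le> inverse c * \<alpha> w" if w: "w \<in> ?C" for w
  proof (cases "w = 0")
    case True then show ?thesis using lin by (simp add: linear_0)
  next
    case False
    then have "inverse (norm w) *\<^sub>R w \<in> ?C \<inter> sphere 0 1"
      using w by (simp add: convex_cone_hull_mul)
    from c(2)[OF this] have "c \<le> inverse (norm w) * \<alpha> w"
      using lin by (simp add: linear_cmul)
    then show ?thesis using False c(1) by (simp add: field_simps)
  qed
  then show ?thesis
    using finite_decompositionsI[OF lin, of "inverse c"] c(1) nonneg by (simp add: less_imp_le)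
qed


subsection \<open>Formal Laurent series\<close>

text \<open>A series is identified with its coefficient function on the exponents in \<open>\<int>\<^sup>n\<close>.\<close>

type_synonym ('a, 'n) laurent = "int ^ 'n \<Rightarrow> 'a"

definition supp :: "('a::zero, 'n) laurent \<Rightarrow> (int ^ 'n) set" where
  "supp f = {k. f k \<noteq> 0}"

text \<open>
  The index set is finite for all \<open>k\<close> when \<open>f\<close> and \<open>g\<close> are supported on a cone satisfying
  \<^term>\<open>finite_decompositions\<close>; otherwise the value is meaningless.
\<close>

definition laurent_mult ::
  "('a::comm_ring_1, 'n::finite) laurent \<Rightarrow> ('a, 'n) laurent \<Rightarrow> ('a, 'n) laurent" where
  "laurent_mult f g = (\<lambda>k. \<Sum>a \<in> {a. a \<in> supp f \<and> k - a \<in> supp g}. f a * g (k - a))"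

definition cone_series :: "(real ^ 'n::finite) set \<Rightarrow> ('a::comm_ring_1, 'n) laurent ring" where
  "cone_series C =
     \<lparr> carrier = {f. real_vec ` supp f \<subseteq> C},
       monoid.mult = laurent_mult,
       one = (\<lambda>k. if k = 0 then 1 else 0),
       zero = (\<lambda>k. 0),
       add = (\<lambda>f g k. f k + g k) \<rparr>"

definition times_var :: "'n::finite \<Rightarrow> ('a, 'n) laurent \<Rightarrow> ('a, 'n) laurent" where
  "times_var i f = (\<lambda>k. f (k - axis i 1))"

definition partial :: "'n::finite \<Rightarrow> ('a::comm_ring_1, 'n) laurent \<Rightarrow> ('a, 'n) laurent" where
  "partial i f = (\<lambda>k. of_int (k $ i + 1) * f (k + axis i 1))"

definition theta :: "'n::finite \<Rightarrow> ('a::comm_ring_1, 'n) laurent \<Rightarrow> ('a, 'n) laurent" where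
  "theta i f = times_var i (partial i f)"

lemma theta_coeff: "theta i f k = of_int (k $ i) * f k"
  by (simp add: theta_def times_var_def partial_def axis_def)

definition gauss_congruences ::
  "nat \<Rightarrow> ('a::comm_ring_1 \<Rightarrow> 'a) \<Rightarrow> ('a, 'n::finite) laurent \<Rightarrow> bool" where
  "gauss_congruences p \<phi> f \<longleftrightarrow>
     (\<forall>(m :: int ^ 'n) r. r \<ge> 1 \<longrightarrow>
        of_nat p ^ r dvd f (of_nat (p ^ r) *s m) - \<phi> (f (of_nat (p ^ (r - 1)) *s m)))"


subsection \<open>Determinants over a commutative ring given by a carrier\<close>

text \<open>Leibniz formula for an \<open>m \<times> m\<close> matrix with rows and columns indexed by \<open>1, \<dots>, m\<close>.\<close>

definition ring_det :: "('b, 'c) ring_scheme \<Rightarrow> nat \<Rightarrow> (nat \<Rightarrow> nat \<Rightarrow> 'b) \<Rightarrow> 'b" where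
  "ring_det R m A =
     (\<Oplus>\<^bsub>R\<^esub> \<sigma> \<in> {\<sigma>. \<sigma> permutes {1..m}}. [sign \<sigma>] \<cdot>\<^bsub>R\<^esub> (\<Otimes>\<^bsub>R\<^esub> i \<in> {1..m}. A i (\<sigma> i)))"

end

theory Submission
  imports Defs
begin

text \<open>
  Each \<open>f\<^sub>j\<close> is an infinite product of factors \<open>1 - a\<^sub>j(d) x\<^sup>d\<close> over nonzero lattice points \<open>d\<close> of the
  cone, whence \<open>\<theta>\<^sub>i f\<^sub>j / f\<^sub>j\<close> is the sum of \<open>- d\<^sub>i a\<^sub>j(d)\<^sup>l x\<^bsup>ld\<^esup>\<close> over all \<open>d\<close> and \<open>l \<ge> 1\<close>. So the coefficient
  of \<open>F\<close> at \<open>N\<close> is the sum, over all families \<open>(d\<^sub>j, l\<^sub>j)\<close> with \<open>\<Sum>\<^sub>j l\<^sub>j d\<^sub>j = N\<close>, of \<open>det (d\<^sub>j)\<^sub>i\<close> times the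
  product of the \<open>- a\<^sub>j(d\<^sub>j)\<^bsup>l\<^sub>j\<^esup>\<close>. Let \<open>p\<^sup>r\<close> divide \<open>N\<close> and let \<open>p\<^sup>s\<close> with \<open>s \<le> r\<close> be the largest such power
  dividing all \<open>l\<^sub>j\<close>. By Cramer's rule \<open>p\<^bsup>r-s\<^esup>\<close> divides the determinant. If \<open>s = 0\<close>, the term vanishes
  modulo \<open>p\<^sup>r\<close>; otherwise it is matched with the term of \<open>(d\<^sub>j, l\<^sub>j / p)\<close> at \<open>N / p\<close>, and
  \<open>a\<^sup>l \<equiv> \<phi>(a)\<^bsup>l/p\<^esup>\<close> modulo \<open>p\<^sup>s\<close>. Only the exponents below \<open>N\<close> matter, so finite products suffice.
\<close>

section \<open>Congruences for determinants and powers\<close>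

text \<open>Indexed by a finite set of naturals because the size \<open>m\<close> varies. This is
  the integer factor left over from \<open>ring_det\<close> once the coefficients are
  expanded.\<close>

definition leibniz_det :: "nat set \<Rightarrow> (nat \<Rightarrow> nat \<Rightarrow> int) \<Rightarrow> int" where
  "leibniz_det I A = (\<Sum>\<sigma> | \<sigma> permutes I. sign \<sigma> * (\<Prod>i\<in>I. A i (\<sigma> i)))"

text \<open>Composing with the transposition of \<open>a\<close> and \<open>b\<close> flips the sign
  of a permutation and keeps its product, so the determinant equals its own negative.\<close>

lemma leibniz_det_identical_columns:
  assumes I: "finite I" and ab: "a \<in> I" "b \<in> I" "a \<noteq> b" and eq: "\<And>i. i \<in> I \<Longrightarrow> A i a = A i b"
  shows "leibniz_det I A = 0"
proof -
  let ?t = "Transposition.transpose a b"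
  have t: "?t permutes I" using ab by (simp add: permutes_swap_id)
  have "leibniz_det I A = (\<Sum>\<sigma> | \<sigma> permutes I. - (sign \<sigma> * (\<Prod>i\<in>I. A i (\<sigma> i))))"
    unfolding leibniz_det_def
  proof (rule sum.reindex_bij_witness[of _ "\<lambda>\<sigma>. ?t \<circ> \<sigma>" "\<lambda>\<sigma>. ?t \<circ> \<sigma>"])
    fix \<sigma> assume "\<sigma> \<in> {\<sigma>. \<sigma> permutes I}"
    then have \<sigma>: "\<sigma> permutes I" by simp
    show "?t \<circ> \<sigma> \<in> {\<sigma>. \<sigma> permutes I}" using permutes_compose[OF \<sigma> t] by simp
    show "?t \<circ> (?t \<circ> \<sigma>) = \<sigma>" by (simp add: fun_eq_iff)
    have "sign (?t \<circ> \<sigma>) = - sign \<sigma>"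
      using ab I \<sigma> t by (subst sign_compose) (auto simp: sign_swap_id permutation_permutes)
    moreover have "(\<Prod>i\<in>I. A i ((?t \<circ> \<sigma>) i)) = (\<Prod>i\<in>I. A i (\<sigma> i))"
      by (intro prod.cong) (auto simp: Transposition.transpose_def eq)
    ultimately show "- (sign (?t \<circ> \<sigma>) * (\<Prod>i\<in>I. A i ((?t \<circ> \<sigma>) i))) = sign \<sigma> * (\<Prod>i\<in>I. A i (\<sigma> i))"
      by simp
  qed (use permutes_compose[OF _ t] in \<open>auto simp: fun_eq_iff\<close>)
  also have "\<dots> = - leibniz_det I A" by (simp add: leibniz_det_def sum_negf)
  finally show ?thesis by simp
qed

text \<open>Expanding column \<open>j0\<close> on the right by linearity gives one determinant for
  each \<open>k\<close>; those with \<open>k\<close> different from \<open>j0\<close> have a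
  repeated column and vanish.\<close>

lemma leibniz_det_cramer:
  assumes I: "finite I" and j0: "j0 \<in> I"
  shows "l j0 * leibniz_det I A
    = leibniz_det I (\<lambda>i j. if j = j0 then \<Sum>k\<in>I. A i k * l k else A i j)"
proof -
  let ?A = "\<lambda>k i j. if j = j0 then A i k else A i j"
  have "(\<Prod>i\<in>I. if \<sigma> i = j0 then \<Sum>k\<in>I. A i k * l k else A i (\<sigma> i))
      = (\<Sum>k\<in>I. l k * (\<Prod>i\<in>I. ?A k i (\<sigma> i)))" if \<sigma>: "\<sigma> permutes I" for \<sigma>
  proof -
    \<comment> \<open>Exactly one factor of each Leibniz product comes from column
      \<open>j0\<close>, so the product is linear in that column.\<close>
    obtain i0 where i0: "i0 \<in> I" "\<sigma> i0 = j0" using permutes_image[OF \<sigma>] j0 by (metis imageE)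
    have ne: "\<sigma> i \<noteq> j0" if "i \<in> I - {i0}" for i
      using that i0 permutes_inj[OF \<sigma>] by (auto simp: inj_def)
    then have "(\<Prod>i\<in>I - {i0}. if \<sigma> i = j0 then X i else A i (\<sigma> i)) = (\<Prod>i\<in>I - {i0}. A i (\<sigma> i))" for X
      by (intro prod.cong) auto
    then show ?thesis
      by (simp add: prod.remove[OF I i0(1)] i0 sum_distrib_right sum_distrib_left mult_ac)
  qed
  then have "leibniz_det I (\<lambda>i j. if j = j0 then \<Sum>k\<in>I. A i k * l k else A i j)
      = (\<Sum>\<sigma> | \<sigma> permutes I. \<Sum>k\<in>I. l k * (sign \<sigma> * (\<Prod>i\<in>I. ?A k i (\<sigma> i))))"
    by (simp add: leibniz_det_def sum_distrib_left mult.left_commute)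
  also have "\<dots> = (\<Sum>k\<in>I. l k * leibniz_det I (?A k))"
    by (subst sum.swap) (simp add: leibniz_det_def sum_distrib_left)
  also have "\<dots> = (\<Sum>k\<in>I. if k = j0 then l k * leibniz_det I A else 0)"
  proof (intro sum.cong refl)
    fix k assume k: "k \<in> I"
    show "l k * leibniz_det I (?A k) = (if k = j0 then l k * leibniz_det I A else 0)"
    proof (cases "k = j0")
      case True
      then have "?A k = A" by (auto simp: fun_eq_iff)
      then show ?thesis using True by simp
    next
      case False
      then show ?thesis using leibniz_det_identical_columns[OF I j0 k] by simp
    qed
  qed
  also have "\<dots> = l j0 * leibniz_det I A" using I j0 by simp
  finally show ?thesis ..
qed

text \<open>After Cramer's rule every Leibniz product contains an entry of the column divisible by
  \<open>q\<close>; coprimality then removes the factor \<open>l j0\<close>.\<close>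

lemma dvd_leibniz_det:
  fixes q :: int
  assumes I: "finite I" and j0: "j0 \<in> I" and coprime: "coprime q (l j0)"
    and dvd: "\<And>i. i \<in> I \<Longrightarrow> q dvd (\<Sum>k\<in>I. A i k * l k)"
  shows "q dvd leibniz_det I A"
proof -
  let ?B = "\<lambda>i j. if j = j0 then \<Sum>k\<in>I. A i k * l k else A i j"
  have "q dvd (\<Prod>i\<in>I. ?B i (\<sigma> i))" if \<sigma>: "\<sigma> permutes I" for \<sigma>
  proof -
    obtain i0 where i0: "i0 \<in> I" "\<sigma> i0 = j0" using permutes_image[OF \<sigma>] j0 by (metis imageE)
    then have "q dvd ?B i0 (\<sigma> i0)" using dvd by simp
    then show ?thesis using dvd_prodI[OF I i0(1), of "\<lambda>i. ?B i (\<sigma> i)"] by (rule dvd_trans)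
  qed
  then have "q dvd l j0 * leibniz_det I A"
    unfolding leibniz_det_cramer[OF I j0] unfolding leibniz_det_def by (intro dvd_sum dvd_mult) auto
  then show ?thesis using coprime by (simp add: coprime_dvd_mult_right_iff)
qed

section \<open>Congruences between powers and products\<close>

lemma dvd_power_diff:
  fixes a b q :: "'a::comm_ring_1"
  assumes "q dvd a - b"
  shows "q dvd a ^ n - b ^ n"
  unfolding power_diff_sumr2 using assms by simp

lemma dvd_prod_diff:
  fixes f g :: "'b \<Rightarrow> 'a::comm_ring_1"
  assumes "\<And>i. i \<in> I \<Longrightarrow> q dvd f i - g i"
  shows "q dvd prod f I - prod g I"
  using assms
proof (induction I rule: infinite_finite_induct)
  case (insert i I)
  have "prod f (insert i I) - prod g (insert i I) = f i * (prod f I - prod g I) + (f i - g i) * prod g I"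
    using insert.hyps by (simp add: algebra_simps)
  then show ?case using insert by simp
qed auto

text \<open>Each further \<open>p\<close>-th power gains a factor \<open>p\<close>: the cofactor of
  \<open>a - b\<close> in \<open>a ^ p - b ^ p\<close> is a sum of \<open>p\<close> terms, each
  congruent to \<open>b ^ (p - 1)\<close> modulo \<open>p\<close>.\<close>

lemma dvd_power_prime_power_diff:
  fixes a b :: "'a::comm_ring_1"
  assumes ab: "of_nat p dvd a - b"
  shows "of_nat p ^ Suc t dvd a ^ (p ^ t) - b ^ (p ^ t)"
proof (induction t)
  case (Suc t)
  let ?a = "a ^ (p ^ t)" and ?b = "b ^ (p ^ t)"
  have "of_nat p dvd (\<Sum>i<p. ?b ^ (p - Suc i) * ?a ^ i)"
  proof -
    have "of_nat p dvd (\<Sum>i<p. ?b ^ (p - Suc i) * ?a ^ i) - (\<Sum>i<p. ?b ^ (p - Suc i) * ?b ^ i)"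
      unfolding sum_subtractf[symmetric] right_diff_distrib[symmetric]
      by (intro dvd_sum dvd_mult dvd_power_diff ab)
    moreover have "(\<Sum>i<p. ?b ^ (p - Suc i) * ?b ^ i) = of_nat p * ?b ^ (p - 1)"
      by (simp flip: power_add)
    ultimately show ?thesis by (metis dvd_diffD dvd_triv_left dvd_diff_commute diff_add_cancel dvd_add)
  qed
  with Suc.IH have "of_nat p ^ Suc t * of_nat p dvd (?a - ?b) * (\<Sum>i<p. ?b ^ (p - Suc i) * ?a ^ i)"
    by (rule mult_dvd_mono)
  moreover have "(?a - ?b) * (\<Sum>i<p. ?b ^ (p - Suc i) * ?a ^ i) = a ^ p ^ Suc t - b ^ p ^ Suc t"
    unfolding power_diff_sumr2[symmetric] by (simp add: mult.commute flip: power_mult)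
  ultimately show ?case by (simp add: mult_ac)
qed (use ab in simp)

text \<open>The number \<open>s\<close> is the least \<open>p\<close>-adic valuation of the family,
  capped at \<open>r\<close>. The cap keeps it defined when all \<open>l j\<close> vanish or
  \<open>I\<close> is empty.\<close>

lemma exists_truncated_valuation:
  fixes l :: "'b \<Rightarrow> nat"
  shows "\<exists>s\<le>r. (\<forall>j\<in>I. p ^ s dvd l j) \<and> (s = r \<or> (\<exists>j\<in>I. \<not> p ^ Suc s dvd l j))"
proof (induction r)
  case (Suc r)
  then obtain s where "s \<le> r" "\<forall>j\<in>I. p ^ s dvd l j" "s = r \<or> (\<exists>j\<in>I. \<not> p ^ Suc s dvd l j)"
    by blast
  then show ?case
    by (cases "\<forall>j\<in>I. p ^ Suc r dvd l j") (metis le_refl, metis le_Suc_eq)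
qed auto

text \<open>Dividing all \<open>l j\<close> by \<open>p ^ s\<close> makes one of them prime to
  \<open>p\<close>, and the linear combinations of the columns remain divisible by
  \<open>p ^ (r - s)\<close>.\<close>

lemma dvd_leibniz_det_if_not_dvd:
  assumes p: "prime p" and I: "finite I" and j: "j \<in> I" "\<not> p ^ Suc s dvd l j" and s: "s \<le> r"
    and l: "\<And>j. j \<in> I \<Longrightarrow> p ^ s dvd l j"
    and dvd: "\<And>i. i \<in> I \<Longrightarrow> int p ^ r dvd (\<Sum>k\<in>I. A i k * int (l k))"
  shows "int p ^ (r - s) dvd leibniz_det I A"
proof (rule dvd_leibniz_det[OF I j(1), where l = "\<lambda>j. int (l j div p ^ s)"])
  have "\<not> p dvd l j div p ^ s"
    using j(2) mult_dvd_mono[of "p ^ s" "p ^ s" p "l j div p ^ s"] l[OF j(1)]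
    by (auto simp: mult.commute)
  then have "coprime (p ^ (r - s)) (l j div p ^ s)"
    using prime_imp_coprime[OF p] by (intro coprime_power_left_iff[THEN iffD2]) auto
  then show "coprime (int p ^ (r - s)) (int (l j div p ^ s))"
    by (metis coprime_int_iff of_nat_power)
  fix i assume i: "i \<in> I"
  have "(\<Sum>k\<in>I. A i k * int (l k)) = int p ^ s * (\<Sum>k\<in>I. A i k * int (l k div p ^ s))"
    unfolding sum_distrib_left
  proof (intro sum.cong refl)
    fix k assume "k \<in> I"
    then have "int (l k) = int p ^ s * int (l k div p ^ s)"
      using l by (metis dvd_mult_div_cancel of_nat_mult of_nat_power)
    then show "A i k * int (l k) = int p ^ s * (A i k * int (l k div p ^ s))" by simp
  qed
  moreover have "int p ^ r = int p ^ s * int p ^ (r - s)" using s by (simp flip: power_add)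
  ultimately have "int p ^ s * int p ^ (r - s) dvd int p ^ s * (\<Sum>k\<in>I. A i k * int (l k div p ^ s))"
    using dvd[OF i] by metis
  then show "int p ^ (r - s) dvd (\<Sum>k\<in>I. A i k * int (l k div p ^ s))"
    by (rule dvd_mult_cancel_left[THEN iffD1, THEN disjE]) (use prime_gt_0_nat[OF p] in auto)
qed

lemma of_int_dvd_of_int: "a dvd b \<Longrightarrow> (of_int a :: 'a::comm_ring_1) dvd of_int b"
  by (elim dvdE) simp

text \<open>The required \<open>r\<close> factors \<open>p\<close> are shared out by the capped
  valuation \<open>s\<close> of the numbers \<open>p * l j\<close>: the determinant supplies
  \<open>r - s\<close> of them and the difference of products supplies \<open>s\<close>.\<close>

lemma dvd_det_times_power_diff:
  fixes x y :: "nat \<Rightarrow> 'a::comm_ring_1"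
  assumes p: "prime p" and I: "finite I"
    and xy: "\<And>j. j \<in> I \<Longrightarrow> of_nat p dvd x j ^ p - y j"
    and dvd: "\<And>i. i \<in> I \<Longrightarrow> int p ^ r dvd (\<Sum>k\<in>I. A i k * int (p * l k))"
  shows "of_nat p ^ r dvd of_int (leibniz_det I A) *
    ((\<Prod>j\<in>I. - (x j ^ (p * l j))) - (\<Prod>j\<in>I. - (y j ^ l j)))"
proof -
  obtain s where s: "s \<le> r" "\<forall>j\<in>I. p ^ s dvd p * l j"
    "s = r \<or> (\<exists>j\<in>I. \<not> p ^ Suc s dvd p * l j)"
    using exists_truncated_valuation[of r I p "\<lambda>j. p * l j"] by (elim exE conjE)
  have "int p ^ (r - s) dvd leibniz_det I A"
    using s(3)
  proof
    assume "\<exists>j\<in>I. \<not> p ^ Suc s dvd p * l j"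
    then obtain j where j: "j \<in> I" "\<not> p ^ Suc s dvd p * l j" ..
    show ?thesis
      by (rule dvd_leibniz_det_if_not_dvd[where l = "\<lambda>j. p * l j", OF p I j s(1)])
        (use s(2) dvd in blast)+
  qed simp
  then have "(of_int (int p ^ (r - s)) :: 'a) dvd of_int (leibniz_det I A)"
    by (rule of_int_dvd_of_int)
  moreover have "of_nat p ^ s dvd (\<Prod>j\<in>I. - (x j ^ (p * l j))) - (\<Prod>j\<in>I. - (y j ^ l j))"
  proof (rule dvd_prod_diff)
    fix j assume j: "j \<in> I"
    show "of_nat p ^ s dvd - (x j ^ (p * l j)) - - (y j ^ l j)"
    proof (cases s)
      case (Suc t)
      \<comment> \<open>Since \<open>s\<close> measures \<open>p * l j\<close> and not
        \<open>l j\<close>, only \<open>p ^ t\<close> with \<open>s = Suc t\<close> divides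
        \<open>l j\<close>. The missing factor is regained from the congruence between
        \<open>x j ^ p\<close> and \<open>y j\<close>.\<close>
      then obtain v where v: "l j = p ^ t * v"
        using s(2)[rule_format, OF j] prime_gt_0_nat[OF p] by (auto simp: dvd_def)
      have "of_nat p ^ s dvd ((x j ^ p) ^ p ^ t) ^ v - ((y j) ^ p ^ t) ^ v"
        unfolding Suc by (intro dvd_power_diff dvd_power_prime_power_diff xy j)
      then have "of_nat p ^ s dvd x j ^ (p * l j) - y j ^ l j"
        by (simp add: v power_mult)
      then have "of_nat p ^ s dvd - (x j ^ (p * l j) - y j ^ l j)" by (simp only: dvd_minus_iff)
      then show ?thesis by simp
    qed simp
  qed
  ultimately have "of_int (int p ^ (r - s)) * of_nat p ^ s dvd
      of_int (leibniz_det I A) * ((\<Prod>j\<in>I. - (x j ^ (p * l j))) - (\<Prod>j\<in>I. - (y j ^ l j)))"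
    by (rule mult_dvd_mono)
  then show ?thesis using s(1) by (simp flip: power_add)
qed

section \<open>Ring endomorphisms applied to polynomial expressions\<close>

lemma
  assumes "ring_endo \<phi>"
  shows ring_endo_0: "\<phi> 0 = 0"
    and ring_endo_uminus: "\<phi> (- a) = - \<phi> a"
    and ring_endo_power: "\<phi> (a ^ n) = \<phi> a ^ n"
    and ring_endo_of_int: "\<phi> (of_int z) = of_int z"
    and ring_endo_sum: "\<phi> (sum f A) = (\<Sum>x\<in>A. \<phi> (f x))"
    and ring_endo_prod: "\<phi> (prod f A) = (\<Prod>x\<in>A. \<phi> (f x))"
proof -
  have 1: "\<phi> 1 = 1" and add: "\<phi> (a + b) = \<phi> a + \<phi> b" and mult: "\<phi> (a * b) = \<phi> a * \<phi> b" for a b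
    using assms by (auto simp: ring_endo_def)
  show 0: "\<phi> 0 = 0" using add[of 0 0] by simp
  show um: "\<phi> (- a) = - \<phi> a" for a using add[of "- a" a] 0 by (simp add: eq_neg_iff_add_eq_0)
  show "\<phi> (a ^ n) = \<phi> a ^ n" by (induction n) (simp_all add: 1 mult)
  have "\<phi> (of_nat n) = of_nat n" for n by (induction n) (simp_all add: 0 1 add)
  then show "\<phi> (of_int z) = of_int z"
    by (cases z rule: int_cases2) (simp_all add: um)
  show "\<phi> (sum f A) = (\<Sum>x\<in>A. \<phi> (f x))"
    by (induction A rule: infinite_finite_induct) (simp_all add: 0 add)
  show "\<phi> (prod f A) = (\<Prod>x\<in>A. \<phi> (f x))"
    by (induction A rule: infinite_finite_induct) (simp_all add: 1 mult)
qed

section \<open>The ring of series supported on a cone\<close>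

text \<open>These properties give the exponents a finite-interval partial order:
  \<open>pointed\<close>, which a positive linear form ensures, yields antisymmetry, and
  \<open>finite_dec\<close> makes every convolution a finite sum.\<close>

locale pointed_cone =
  fixes C :: "(real ^ 'n::finite) set"
  assumes zero_mem: "0 \<in> C"
    and add_mem: "x \<in> C \<Longrightarrow> y \<in> C \<Longrightarrow> x + y \<in> C"
    and pointed: "x \<in> C \<Longrightarrow> - x \<in> C \<Longrightarrow> x = 0"
    and finite_dec: "finite_decompositions C"
begin

abbreviation R :: "('a::comm_ring_1, 'n) laurent ring" where
  "R \<equiv> cone_series C"

definition K :: "(int ^ 'n) set" where
  "K = {k. real_vec k \<in> C}"

text \<open>The interval from 0 to \<open>k\<close> in the order where \<open>a\<close> precedes
  \<open>b\<close> if \<open>b - a\<close> lies in \<open>K\<close>. Its cardinality replaces a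
  degree as induction measure.\<close>

definition below :: "int ^ 'n \<Rightarrow> (int ^ 'n) set" where
  "below k = {a. a \<in> K \<and> k - a \<in> K}"

lemma real_vec_simps:
  "real_vec (0 :: int ^ 'n) = 0" "real_vec (a + b :: int ^ 'n) = real_vec a + real_vec b"
  "real_vec (- a :: int ^ 'n) = - real_vec a"
  by (simp_all add: real_vec_def vec_eq_iff)

lemma real_vec_eq_0: "real_vec (a :: int ^ 'n) = 0 \<longleftrightarrow> a = 0"
  by (simp add: real_vec_def vec_eq_iff)

lemma zero_in_K [simp]: "0 \<in> K"
  by (simp add: K_def real_vec_simps zero_mem)

lemma add_in_K: "a \<in> K \<Longrightarrow> b \<in> K \<Longrightarrow> a + b \<in> K"
  by (simp add: K_def real_vec_simps add_mem)

lemma K_pointed: "a \<in> K \<Longrightarrow> - a \<in> K \<Longrightarrow> a = 0"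
  using pointed[of "real_vec a"] by (simp add: K_def real_vec_simps real_vec_eq_0)

lemma nat_scale_in_K: "a \<in> K \<Longrightarrow> of_nat l *s a \<in> K"
  by (induction l) (auto simp: vector_sadd_rdistrib add_in_K)

lemma finite_below [simp]: "finite (below k)"
  using finite_dec by (simp add: below_def K_def finite_decompositions_def)

lemma below_trans: "N - k \<in> K \<Longrightarrow> a \<in> below k \<Longrightarrow> a \<in> below N"
  using add_in_K[of "N - k" "k - a"] by (auto simp: below_def)

text \<open>The inclusion of intervals is strict because \<open>k\<close> lies in the larger one,
  while pointedness keeps it out of the smaller one.\<close>

lemma card_below_less:
  assumes "k \<in> K" "d \<in> K" "d \<noteq> 0"
  shows "card (below (k - d)) < card (below k)"
proof (rule psubset_card_mono)
  have "below (k - d) \<subseteq> below k"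
  proof
    fix a assume "a \<in> below (k - d)"
    then show "a \<in> below k"
      using add_in_K[of "k - d - a" d] assms(2) by (simp add: below_def algebra_simps)
  qed
  moreover have "k \<in> below k" "k \<notin> below (k - d)"
    using assms K_pointed by (auto simp: below_def)
  ultimately show "below (k - d) \<subset> below k" by blast
qed simp

lemma carrier_iff: "f \<in> carrier R \<longleftrightarrow> (\<forall>k. k \<notin> K \<longrightarrow> f k = 0)"
  by (auto simp: cone_series_def K_def supp_def)

lemma add_coeff: "(f \<oplus>\<^bsub>R\<^esub> g) k = f k + g k"
  by (simp add: cone_series_def)

lemma one_coeff: "\<one>\<^bsub>R\<^esub> k = (if k = 0 then 1 else 0)"
  by (simp add: cone_series_def)

lemma zero_coeff: "\<zero>\<^bsub>R\<^esub> k = 0"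
  by (simp add: cone_series_def)

text \<open>Replaces the index set built from the supports by one depending on \<open>k\<close>
  alone, so that sums for different series can be combined.\<close>

lemma mult_coeff:
  assumes "f \<in> carrier R" "g \<in> carrier R"
  shows "(f \<otimes>\<^bsub>R\<^esub> g) k = (\<Sum>a\<in>below k. f a * g (k - a))"
proof -
  have "(\<Sum>a \<in> {a. a \<in> supp f \<and> k - a \<in> supp g}. f a * g (k - a)) = (\<Sum>a\<in>below k. f a * g (k - a))"
    using assms by (intro sum.mono_neutral_left finite_below) (auto simp: carrier_iff supp_def below_def)
  then show ?thesis by (simp add: cone_series_def laurent_mult_def)
qed

lemma mult_closed:
  assumes "f \<in> carrier R" "g \<in> carrier R"
  shows "f \<otimes>\<^bsub>R\<^esub> g \<in> carrier R"
  unfolding carrier_iff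
proof (intro allI impI)
  fix k assume "k \<notin> K"
  then have "below k = {}" using add_in_K by (force simp: below_def)
  then show "(f \<otimes>\<^bsub>R\<^esub> g) k = 0" by (simp add: mult_coeff[OF assms])
qed

lemma mult_commute:
  assumes "f \<in> carrier R" "g \<in> carrier R"
  shows "f \<otimes>\<^bsub>R\<^esub> g = g \<otimes>\<^bsub>R\<^esub> f"
proof
  fix k
  have "(\<Sum>a\<in>below k. f a * g (k - a)) = (\<Sum>a\<in>below k. g a * f (k - a))"
    by (rule sum.reindex_bij_witness[of _ "\<lambda>a. k - a" "\<lambda>a. k - a"]) (auto simp: below_def mult.commute)
  then show "(f \<otimes>\<^bsub>R\<^esub> g) k = (g \<otimes>\<^bsub>R\<^esub> f) k"
    using assms by (simp add: mult_coeff)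
qed

lemma mult_assoc:
  assumes "f \<in> carrier R" "g \<in> carrier R" "h \<in> carrier R"
  shows "(f \<otimes>\<^bsub>R\<^esub> g) \<otimes>\<^bsub>R\<^esub> h = f \<otimes>\<^bsub>R\<^esub> (g \<otimes>\<^bsub>R\<^esub> h)"
proof
  fix k
  have "((f \<otimes>\<^bsub>R\<^esub> g) \<otimes>\<^bsub>R\<^esub> h) k
      = (\<Sum>a\<in>below k. \<Sum>b\<in>below a. f b * g (a - b) * h (k - a))"
    using assms by (simp add: mult_coeff mult_closed sum_distrib_right)
  also have "\<dots> = (\<Sum>(a, b)\<in>Sigma (below k) below. f b * g (a - b) * h (k - a))"
    by (simp add: sum.Sigma)
  \<comment> \<open>Both sides run over the ways to split \<open>k\<close> into three exponents
    \<open>b\<close>, \<open>c\<close> and \<open>k - b - c\<close>, with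
    \<open>a = b + c\<close>.\<close>
  also have "\<dots> = (\<Sum>(b, c)\<in>Sigma (below k) (\<lambda>b. below (k - b)). f b * (g c * h (k - b - c)))"
  proof (rule sum.reindex_bij_witness[of _ "\<lambda>(b, c). (b + c, b)" "\<lambda>(a, b). (b, a - b)"])
    fix x assume "x \<in> Sigma (below k) below"
    then show "(case x of (a, b) \<Rightarrow> (b, a - b)) \<in> Sigma (below k) (\<lambda>b. below (k - b))"
      using below_trans by (auto simp: below_def)
  next
    fix x assume "x \<in> Sigma (below k) (\<lambda>b. below (k - b))"
    then show "(case x of (b, c) \<Rightarrow> (b + c, b)) \<in> Sigma (below k) below"
      using add_in_K by (auto simp: below_def diff_diff_eq)
  qed (auto simp: algebra_simps)
  also have "\<dots> = (\<Sum>b\<in>below k. \<Sum>c\<in>below (k - b). f b * (g c * h (k - b - c)))"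
    by (simp add: sum.Sigma)
  also have "\<dots> = (f \<otimes>\<^bsub>R\<^esub> (g \<otimes>\<^bsub>R\<^esub> h)) k"
    using assms by (simp add: mult_coeff mult_closed sum_distrib_left)
  finally show "((f \<otimes>\<^bsub>R\<^esub> g) \<otimes>\<^bsub>R\<^esub> h) k = (f \<otimes>\<^bsub>R\<^esub> (g \<otimes>\<^bsub>R\<^esub> h)) k" .
qed

lemma one_closed: "\<one>\<^bsub>R\<^esub> \<in> carrier R"
  by (auto simp: carrier_iff one_coeff)

lemma one_mult:
  assumes "f \<in> carrier R"
  shows "\<one>\<^bsub>R\<^esub> \<otimes>\<^bsub>R\<^esub> f = f"
proof
  fix k
  have "(\<one>\<^bsub>R\<^esub> \<otimes>\<^bsub>R\<^esub> f) k = (\<Sum>a\<in>below k. if a = 0 then f k else 0)"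
    using assms by (simp add: mult_coeff one_closed one_coeff if_distrib[of "\<lambda>x. x * _"] cong: if_cong)
  also have "\<dots> = f k"
    using assms by (cases "k \<in> K") (simp_all add: carrier_iff, simp_all add: below_def)
  finally show "(\<one>\<^bsub>R\<^esub> \<otimes>\<^bsub>R\<^esub> f) k = f k" .
qed

lemma add_closed: "f \<in> carrier R \<Longrightarrow> g \<in> carrier R \<Longrightarrow> f \<oplus>\<^bsub>R\<^esub> g \<in> carrier R"
  by (simp add: carrier_iff add_coeff)

lemma distrib:
  assumes "f \<in> carrier R" "g \<in> carrier R" "h \<in> carrier R"
  shows "(f \<oplus>\<^bsub>R\<^esub> g) \<otimes>\<^bsub>R\<^esub> h = (f \<otimes>\<^bsub>R\<^esub> h) \<oplus>\<^bsub>R\<^esub> (g \<otimes>\<^bsub>R\<^esub> h)"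
  using assms
  by (auto simp: fun_eq_iff mult_coeff add_coeff add_closed distrib_right sum.distrib)

sublocale R: cring "R :: ('a::comm_ring_1, 'n) laurent ring"
proof (rule cringI)
  show "abelian_group (R :: ('a, 'n) laurent ring)"
  proof (rule abelian_groupI)
    fix f :: "('a, 'n) laurent" assume "f \<in> carrier R"
    then show "\<exists>g\<in>carrier R. g \<oplus>\<^bsub>R\<^esub> f = \<zero>\<^bsub>R\<^esub>"
      by (intro bexI[of _ "\<lambda>k. - f k"]) (auto simp: carrier_iff add_coeff zero_coeff)
  qed (auto simp: carrier_iff add_coeff zero_coeff fun_eq_iff algebra_simps)
  show "comm_monoid (R :: ('a, 'n) laurent ring)"
    by (rule comm_monoidI) (blast intro: mult_closed one_closed mult_assoc one_mult mult_commute)+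
qed (simp_all add: distrib)

text \<open>Comparing coefficients at \<open>k\<close> in the equation for the inverse
  \<open>g\<close> expresses \<open>g k\<close> by values at \<open>k - a\<close> with
  \<open>a\<close> nonzero. The recursion is well-founded because these exponents have smaller
  intervals.\<close>

lemma unit_if_constant_coeff_1:
  fixes f :: "('a::comm_ring_1, 'n) laurent"
  assumes f: "f \<in> carrier R" and f0: "f 0 = 1"
  shows "f \<in> Units R"
proof -
  let ?r = "inv_image less_than (\<lambda>k. card (below k))"
  let ?P = "\<lambda>g k y. (k \<notin> K \<longrightarrow> y = 0) \<and>
    (k \<in> K \<longrightarrow> y = \<one>\<^bsub>R\<^esub> k - (\<Sum>a\<in>below k - {0}. f a * g (k - a)))"
  have "\<exists>g :: ('a, 'n) laurent. \<forall>k. ?P g k (g k)"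
  proof (rule dependent_wf_choice[of ?r])
    fix g h :: "('a, 'n) laurent" and k y
    assume gh: "\<And>z. (z, k) \<in> ?r \<Longrightarrow> g z = h z"
    show "?P g k y = ?P h k y"
    proof (cases "k \<in> K")
      case True
      have "(\<Sum>a\<in>below k - {0}. f a * g (k - a)) = (\<Sum>a\<in>below k - {0}. f a * h (k - a))"
        using True by (intro sum.cong refl, subst gh) (auto simp: below_def intro!: card_below_less[unfolded below_def])
      then show ?thesis by simp
    qed simp
  qed auto
  then obtain g :: "('a, 'n) laurent" where g: "\<And>k. ?P g k (g k)" by blast
  have gc: "g \<in> carrier R" using g by (simp add: carrier_iff)
  have "f \<otimes>\<^bsub>R\<^esub> g = \<one>\<^bsub>R\<^esub>"
  proof
    fix k
    show "(f \<otimes>\<^bsub>R\<^esub> g) k = \<one>\<^bsub>R\<^esub> k"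
    proof (cases "k \<in> K")
      case True
      then have "(f \<otimes>\<^bsub>R\<^esub> g) k = f 0 * g (k - 0) + (\<Sum>a\<in>below k - {0}. f a * g (k - a))"
        by (subst mult_coeff[OF f gc], subst sum.remove[of _ 0]) (auto simp: below_def finite_below[unfolded below_def])
      then show ?thesis using g[of k] True f0 by simp
    next
      case False
      then show ?thesis using R.m_closed[OF f gc] R.one_closed carrier_iff by metis
    qed
  qed
  then show ?thesis using f gc R.m_comm[OF f gc] by (auto simp: Units_def)
qed

section \<open>Coefficients of finite sums and integer multiples\<close>

lemma finsum_coeff:
  assumes "finite A" "\<And>x. x \<in> A \<Longrightarrow> g x \<in> carrier R"
  shows "finsum R g A k = (\<Sum>x\<in>A. g x k)"
  using assms
proof (induction A rule: finite_induct)
  case (insert x A)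
  then have "finsum R g (insert x A) = g x \<oplus>\<^bsub>R\<^esub> finsum R g A"
    by (intro R.finsum_insert) auto
  with insert show ?case by (simp add: add_coeff)
qed (simp add: zero_coeff)

lemma uminus_coeff:
  assumes "f \<in> carrier R"
  shows "(\<ominus>\<^bsub>R\<^esub> f) k = - f k"
  using R.l_neg[OF assms] add_coeff[of "\<ominus>\<^bsub>R\<^esub> f" f k] zero_coeff[of k]
  by (metis eq_neg_iff_add_eq_0)

lemma add_pow_nat_coeff: "([(z::nat)] \<cdot>\<^bsub>R\<^esub> f) k = of_nat z * f k"
  if "f \<in> carrier R"
  by (induction z) (use that in \<open>simp_all add: add_coeff zero_coeff distrib_right\<close>)

lemma add_pow_int_coeff: "([(z::int)] \<cdot>\<^bsub>R\<^esub> f) k = of_int z * f k"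
  if f: "f \<in> carrier R"
proof (cases z)
  case (nonneg n)
  then show ?thesis
    using add_pow_nat_coeff[OF f, of n] by (simp add: add_pow_def int_pow_int)
next
  case (neg n)
  have "[z] \<cdot>\<^bsub>R\<^esub> f = \<ominus>\<^bsub>R\<^esub> ([Suc n] \<cdot>\<^bsub>R\<^esub> f)"
    using R.add.int_pow_neg_int[OF f, of "Suc n"] neg by (simp add: a_inv_def del: R.add.nat_pow_Suc)
  then have "([z] \<cdot>\<^bsub>R\<^esub> f) k = - (of_nat (Suc n) * f k)"
    using f by (simp only: uminus_coeff add_pow_nat_coeff R.add.nat_pow_closed)
  then show ?thesis unfolding neg by (simp add: algebra_simps)
qed


section \<open>Truncated Euler products\<close>

lemma theta_closed [simp]: "f \<in> carrier R \<Longrightarrow> theta i f \<in> carrier R"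
  by (simp add: carrier_iff theta_coeff)

text \<open>In each convolution term the coordinate \<open>k $ i\<close> splits as the sum of those
  of \<open>a\<close> and \<open>k - a\<close>.\<close>

lemma theta_mult:
  assumes "f \<in> carrier R" "g \<in> carrier R"
  shows "theta i (f \<otimes>\<^bsub>R\<^esub> g) = (theta i f \<otimes>\<^bsub>R\<^esub> g) \<oplus>\<^bsub>R\<^esub> (f \<otimes>\<^bsub>R\<^esub> theta i g)"
  using assms
  by (simp add: fun_eq_iff theta_coeff mult_coeff add_coeff sum_distrib_left algebra_simps
      flip: sum.distrib)

text \<open>
  The series vanishing at all \<open>k\<close> with \<open>N - k\<close> in the cone form an ideal stable under every
  \<^const>\<open>theta\<close>; \<open>agree N\<close> is congruence modulo this ideal.
\<close>

definition agree :: "int ^ 'n \<Rightarrow> ('a, 'n) laurent \<Rightarrow> ('a, 'n) laurent \<Rightarrow> bool" where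
  "agree N f g \<longleftrightarrow> (\<forall>k. N - k \<in> K \<longrightarrow> f k = g k)"

lemma agree_refl [simp]: "agree N f f"
  by (simp add: agree_def)

lemma agree_sym: "agree N f g \<Longrightarrow> agree N g f"
  by (simp add: agree_def)

lemma agree_trans [trans]: "agree N f g \<Longrightarrow> agree N g h \<Longrightarrow> agree N f h"
  by (simp add: agree_def)

lemma agree_theta: "agree N f g \<Longrightarrow> agree N (theta i f) (theta i g)"
  by (simp add: agree_def theta_coeff)

lemma agree_add: "agree N f f' \<Longrightarrow> agree N g g' \<Longrightarrow> agree N (f \<oplus>\<^bsub>R\<^esub> g) (f' \<oplus>\<^bsub>R\<^esub> g')"
  by (simp add: agree_def add_coeff)

text \<open>If \<open>k\<close> precedes \<open>N\<close>, then so do both parts \<open>a\<close>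
  and \<open>k - a\<close> of any decomposition of \<open>k\<close> in the cone.\<close>

lemma agree_mult:
  assumes "agree N f f'" "agree N g g'"
    and c: "f \<in> carrier R" "f' \<in> carrier R" "g \<in> carrier R" "g' \<in> carrier R"
  shows "agree N (f \<otimes>\<^bsub>R\<^esub> g) (f' \<otimes>\<^bsub>R\<^esub> g')"
  unfolding agree_def
proof (intro allI impI)
  fix k assume k: "N - k \<in> K"
  have "f a * g (k - a) = f' a * g' (k - a)" if "a \<in> below k" for a
  proof -
    have "N - a \<in> K" using below_trans[OF k that] by (simp add: below_def)
    moreover have "N - (k - a) \<in> K"
      using add_in_K[OF k, of a] that by (simp add: below_def algebra_simps)
    ultimately show ?thesis using assms by (simp add: agree_def)
  qed
  then show "(f \<otimes>\<^bsub>R\<^esub> g) k = (f' \<otimes>\<^bsub>R\<^esub> g') k" using c by (simp add: mult_coeff)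
qed

lemma agree_finprod:
  assumes "finite I" "\<And>i. i \<in> I \<Longrightarrow> agree N (f i) (g i)"
    and "\<And>i. i \<in> I \<Longrightarrow> f i \<in> carrier R" "\<And>i. i \<in> I \<Longrightarrow> g i \<in> carrier R"
  shows "agree N (finprod R f I) (finprod R g I)"
  using assms
proof (induction I rule: finite_induct)
  case (insert i I)
  then have "finprod R f (insert i I) = f i \<otimes>\<^bsub>R\<^esub> finprod R f I"
    and "finprod R g (insert i I) = g i \<otimes>\<^bsub>R\<^esub> finprod R g I"
    by (auto intro!: R.finprod_insert)
  then show ?case using insert by (auto intro!: agree_mult R.finprod_closed)
qed simp

section \<open>Finite sums of monomials\<close>

text \<open>The monomials \<open>c q\<close> times x to the power \<open>e q\<close> keep their
  labels \<open>q\<close> even when exponents coincide, so that terms can later be paired one by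
  one.\<close>

definition lpoly :: "'q set \<Rightarrow> ('q \<Rightarrow> 'a::comm_ring_1) \<Rightarrow> ('q \<Rightarrow> int ^ 'n) \<Rightarrow> ('a, 'n) laurent" where
  "lpoly Q c e = (\<lambda>k. \<Sum>q\<in>Q. if e q = k then c q else 0)"

lemma lpoly_closed: "(\<And>q. q \<in> Q \<Longrightarrow> e q \<in> K) \<Longrightarrow> lpoly Q c e \<in> carrier R"
  by (auto simp: carrier_iff lpoly_def intro!: sum.neutral)

lemma lpoly_mult:
  assumes e: "\<And>q. q \<in> Q \<Longrightarrow> e q \<in> K" "\<And>q. q \<in> Q' \<Longrightarrow> e' q \<in> K"
  shows "lpoly Q c e \<otimes>\<^bsub>R\<^esub> lpoly Q' c' e'
    = lpoly (Q \<times> Q') (\<lambda>(q, q'). c q * c' q') (\<lambda>(q, q'). e q + e' q')"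
proof
  fix k
  have "(lpoly Q c e \<otimes>\<^bsub>R\<^esub> lpoly Q' c' e') k = (\<Sum>a\<in>below k. \<Sum>q\<in>Q. \<Sum>q'\<in>Q'.
      if e q = a then (if e q + e' q' = k then c q * c' q' else 0) else 0)"
    using lpoly_closed[of Q e c, OF e(1)] lpoly_closed[of Q' e' c', OF e(2)]
    by (simp add: mult_coeff, simp add: lpoly_def sum_product)
      (intro sum.cong refl, auto simp: algebra_simps)
  also have "\<dots> = (\<Sum>q\<in>Q. \<Sum>q'\<in>Q'. \<Sum>a\<in>below k.
      if e q = a then (if e q + e' q' = k then c q * c' q' else 0) else 0)"
    by (subst sum.swap, intro sum.cong refl, rule sum.swap)
  \<comment> \<open>Only \<open>a = e q\<close> contributes, and it lies in \<open>below k\<close>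
    as soon as the exponents add up to \<open>k\<close>.\<close>
  also have "\<dots> = (\<Sum>q\<in>Q. \<Sum>q'\<in>Q'. if e q + e' q' = k then c q * c' q' else 0)"
    by (intro sum.cong refl) (use e in \<open>auto simp: below_def sum.delta'[OF finite_below[unfolded below_def]]\<close>)
  also have "\<dots> = lpoly (Q \<times> Q') (\<lambda>(q, q'). c q * c' q') (\<lambda>(q, q'). e q + e' q') k"
    by (simp add: lpoly_def sum.cartesian_product split_def)
  finally show "(lpoly Q c e \<otimes>\<^bsub>R\<^esub> lpoly Q' c' e') k
    = lpoly (Q \<times> Q') (\<lambda>(q, q'). c q * c' q') (\<lambda>(q, q'). e q + e' q') k" .
qed

lemma lpoly_reindex: "inj_on h A \<Longrightarrow> lpoly (h ` A) c e = lpoly A (c \<circ> h) (e \<circ> h)"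
  by (simp add: lpoly_def sum.reindex comp_def)

text \<open>Distributivity: \<open>w\<close> chooses one monomial from each factor.\<close>

lemma finprod_lpoly:
  assumes "finite I" and e: "\<And>q. q \<in> Q \<Longrightarrow> e q \<in> K"
  shows "finprod R (\<lambda>i. lpoly Q (c i) e) I
    = lpoly (PiE I (\<lambda>_. Q)) (\<lambda>w. \<Prod>i\<in>I. c i (w i)) (\<lambda>w. \<Sum>i\<in>I. e (w i))"
  using assms(1)
proof (induction I rule: finite_induct)
  case empty
  show ?case by (auto simp: lpoly_def one_coeff)
next
  case (insert x I)
  let ?P = "PiE I (\<lambda>_. Q)"
  have eI: "(\<Sum>i\<in>I. e (w i)) \<in> K" if "w \<in> ?P" for w
  proof -
    have "(\<Sum>i\<in>J. e (w i)) \<in> K" if "finite J" "J \<subseteq> I" for J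
      using that \<open>w \<in> ?P\<close> by (induction J rule: finite_induct) (auto intro!: add_in_K e)
    then show ?thesis using insert.hyps by blast
  qed
  have upd: "(\<Prod>i\<in>I. c i ((w(x := q)) i)) = (\<Prod>i\<in>I. c i (w i))"
    "(\<Sum>i\<in>I. e ((w(x := q)) i)) = (\<Sum>i\<in>I. e (w i))" for w q
    using insert.hyps by (auto intro!: prod.cong sum.cong)
  have "finprod R (\<lambda>i. lpoly Q (c i) e) (insert x I)
      = lpoly Q (c x) e \<otimes>\<^bsub>R\<^esub> finprod R (\<lambda>i. lpoly Q (c i) e) I"
    using insert.hyps e by (intro R.finprod_insert) (auto intro!: lpoly_closed)
  also have "\<dots> = lpoly (Q \<times> ?P) (\<lambda>(q, w). c x q * (\<Prod>i\<in>I. c i (w i)))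
      (\<lambda>(q, w). e q + (\<Sum>i\<in>I. e (w i)))"
    unfolding insert.IH using e eI by (rule lpoly_mult)
  also have "\<dots> = lpoly (PiE (insert x I) (\<lambda>_. Q))
      (\<lambda>w. \<Prod>i\<in>insert x I. c i (w i)) (\<lambda>w. \<Sum>i\<in>insert x I. e (w i))"
    unfolding PiE_insert_eq lpoly_reindex[OF inj_combinator[OF insert.hyps(2), of "\<lambda>_. Q"]]
    using insert.hyps by (simp add: comp_def split_def upd del: fun_upd_apply) simp
  finally show ?case .
qed

text \<open>Here \<open>u\<close> is the binomial 1 - b x^d, so multiplying by it subtracts
  \<open>b\<close> times a shift by \<open>d\<close>.\<close>

lemma linear_factor_mult:
  assumes d: "d \<in> K" "d \<noteq> 0" and g: "g \<in> carrier R"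
    and u: "u = (\<lambda>k. if k = 0 then 1 else if k = d then - b else 0)"
  shows "u \<in> carrier R" "(u \<otimes>\<^bsub>R\<^esub> g) k = g k - b * g (k - d)"
proof -
  show uc: "u \<in> carrier R" using d by (auto simp: carrier_iff u)
  have "(u \<otimes>\<^bsub>R\<^esub> g) k = (\<Sum>a\<in>below k. (if a = 0 then g k else 0) - (if a = d then b * g (k - d) else 0))"
    unfolding mult_coeff[OF uc g] by (intro sum.cong refl) (use d in \<open>auto simp: u\<close>)
  also have "\<dots> = g k - b * g (k - d)"
    using d g by (auto simp: sum_subtractf) (auto simp: below_def carrier_iff)
  finally show "(u \<otimes>\<^bsub>R\<^esub> g) k = g k - b * g (k - d)" .
qed

text \<open>
  The pair \<open>(d, l)\<close> indexes the term \<open>- d\<^sub>i a(d)\<^sup>l x\<^bsup>ld\<^esup>\<close> of the geometric expansion of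
  \<open>\<theta>\<^sub>i u / u\<close>, where \<open>u = 1 - a(d) x\<^sup>d\<close>.
\<close>

definition dlog_term :: "'n \<Rightarrow> (int ^ 'n \<Rightarrow> 'a::comm_ring_1) \<Rightarrow> (int ^ 'n) \<times> nat \<Rightarrow> 'a" where
  "dlog_term i a = (\<lambda>(d, l). of_int (d $ i) * - (a d ^ l))"

definition exponent :: "(int ^ 'n) \<times> nat \<Rightarrow> int ^ 'n" where
  "exponent = (\<lambda>(d, l). of_nat l *s d)"

lemma exponent_in_K: "T \<subseteq> K \<Longrightarrow> q \<in> T \<times> A \<Longrightarrow> exponent q \<in> K"
  by (auto simp: exponent_def nat_scale_in_K)

text \<open>The geometric sum telescopes: the shift by \<open>d\<close> turns its term
  \<open>l\<close> into term \<open>l + 1\<close>. This leaves the first term, which is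
  \<open>theta i u\<close>, and the term at \<open>Suc L\<close> times \<open>d\<close>, which
  assumption \<open>L\<close> puts out of range.\<close>

lemma theta_linear_factor:
  assumes d: "d \<in> K" "d \<noteq> 0" and L: "N - of_nat (Suc L) *s d \<notin> K"
    and u: "u = (\<lambda>k. if k = 0 then 1 else if k = d then - (a d) else 0)"
  shows "agree N (theta i u) (u \<otimes>\<^bsub>R\<^esub> lpoly ({d} \<times> {1..L}) (dlog_term i a) exponent)"
  unfolding agree_def
proof (intro allI impI)
  fix k assume k: "N - k \<in> K"
  let ?g = "lpoly ({d} \<times> {1..L}) (dlog_term i a) exponent"
  define h where "h l = (if of_nat l *s d = k then of_int (d $ i) * - (a d ^ l) else 0)" for l
  have gc: "?g \<in> carrier R"
    by (rule lpoly_closed, rule exponent_in_K) (use d in auto)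
  have g: "?g k' = (\<Sum>l=1..L. if of_nat l *s d = k' then of_int (d $ i) * - (a d ^ l) else 0)" for k'
  proof -
    have "{d} \<times> {1..L} = Pair d ` {1..L}" by auto
    then show ?thesis
      by (simp add: lpoly_def sum.reindex inj_on_def dlog_term_def exponent_def comp_def cong: if_cong)
  qed
  have "(u \<otimes>\<^bsub>R\<^esub> ?g) k = ?g k - a d * ?g (k - d)"
    by (rule linear_factor_mult(2)[OF d gc u])
  also have "a d * ?g (k - d) = (\<Sum>l=1..L. h (Suc l))"
    unfolding g sum_distrib_left
    by (intro sum.cong refl) (auto simp: h_def vector_sadd_rdistrib algebra_simps)
  also have "?g k - (\<Sum>l=1..L. h (Suc l)) = h 1 - h (Suc L)"
    unfolding g h_def[symmetric] by (induction L) (auto simp: algebra_simps)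
  also have "h (Suc L) = 0" using L k by (auto simp: h_def)
  also have "h 1 - 0 = theta i u k" using d by (auto simp: h_def theta_coeff u)
  finally show "theta i u k = (u \<otimes>\<^bsub>R\<^esub> ?g) k" ..
qed

text \<open>Induction on the downward closed set \<open>T\<close>. The product \<open>P\<close>
  gains one factor 1 - a(d) x^d for each \<open>d\<close> in \<open>T\<close>, with a(d) chosen to
  correct the coefficient at \<open>d\<close>, and the logarithmic derivatives of the factors add
  up.\<close>

lemma truncated_euler_product:
  fixes f :: "('a::comm_ring_1, 'n) laurent"
  assumes f: "f \<in> carrier R" and "finite T" "T \<subseteq> K - {0}"
    and "\<forall>k\<in>T. below k \<subseteq> insert 0 T"
  shows "\<exists>a P. P \<in> carrier R \<and> P 0 = 1 \<and> (\<forall>k\<in>T. P k = f k) \<and>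
    (\<forall>i N L. (\<forall>d\<in>T. N - of_nat (Suc L) *s d \<notin> K) \<longrightarrow>
      agree N (theta i P) (P \<otimes>\<^bsub>R\<^esub> lpoly (T \<times> {1..L}) (dlog_term i a) exponent))"
  using assms(2-)
proof (induction T rule: finite_psubset_induct)
  case (psubset T)
  show ?case
  proof (cases "T = {}")
    case True
    have 1: "theta i \<one>\<^bsub>R\<^esub> = (\<zero>\<^bsub>R\<^esub> :: ('a, 'n) laurent)" for i
      by (auto simp: theta_coeff one_coeff zero_coeff)
    have 2: "lpoly {} (c :: (int ^ 'n) \<times> nat \<Rightarrow> 'a) e = \<zero>\<^bsub>R\<^esub>" for c e
      by (auto simp: lpoly_def zero_coeff)
    have 3: "agree N (theta i \<one>\<^bsub>R\<^esub>) (\<one>\<^bsub>R\<^esub> \<otimes>\<^bsub>R\<^esub> lpoly (T \<times> {1..L}) (dlog_term i (\<lambda>_. 0 :: 'a)) exponent)" for i N L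
      unfolding True Sigma_empty1 1 2 by simp
    show ?thesis
    proof (rule exI[of _ "\<lambda>_. 0"], rule exI[of _ "\<one>\<^bsub>R\<^esub>"], intro conjI allI impI)
      show "\<one>\<^bsub>R\<^esub> 0 = (1 :: 'a)" by (simp add: one_coeff)
    qed (use 3 in \<open>simp_all add: True\<close>)
  next
    case False
    \<comment> \<open>An element \<open>d\<close> with the largest interval precedes no other
      element of \<open>T\<close>, so removing it leaves a downward closed set.\<close>
    have "Max ((\<lambda>k. card (below k)) ` T) \<in> (\<lambda>k. card (below k)) ` T"
      using psubset.hyps False by (intro Max_in) auto
    then obtain d where dT: "d \<in> T" and "card (below d) = Max ((\<lambda>k. card (below k)) ` T)"
      by auto
    then have max: "card (below k) \<le> card (below d)" if "k \<in> T" for k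
      using psubset.hyps that by simp
    define T' where "T' = T - {d}"
    have d: "d \<in> K" "d \<noteq> 0" using dT psubset.prems(1) by auto
    have T': "T' \<subset> T" "T' \<subseteq> K - {0}" "T = {d} \<union> T'" "d \<notin> T'"
      using dT psubset.prems(1) by (auto simp: T'_def)
    have down: "\<forall>k\<in>T'. below k \<subseteq> insert 0 T'"
    proof (intro ballI subsetI)
      fix k a assume that: "k \<in> T'" "a \<in> below k"
      have "a \<noteq> d"
      proof
        assume "a = d"
        then have "card (below (k - (k - d))) < card (below k)"
          using that T' by (intro card_below_less) (auto simp: below_def)
        then show False using max[of k] that T' by auto
      qed
      moreover have "a \<in> insert 0 T" using that psubset.prems(2) T'(1) by blast
      ultimately show "a \<in> insert 0 T'" by (simp add: T'_def)
    qed
    obtain a P where IH: "P \<in> carrier R \<and> P 0 = 1 \<and> (\<forall>k\<in>T'. P k = f k) \<and>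
      (\<forall>i N L. (\<forall>d\<in>T'. N - of_nat (Suc L) *s d \<notin> K) \<longrightarrow>
        agree N (theta i P) (P \<otimes>\<^bsub>R\<^esub> lpoly (T' \<times> {1..L}) (dlog_term i a) exponent))"
      using psubset.IH[OF T'(1,2) down] by (elim exE)
    then have P: "P \<in> carrier R" "P 0 = 1" and Pf: "\<forall>k\<in>T'. P k = f k" by simp_all
    note theta_P = IH[THEN conjunct2, THEN conjunct2, THEN conjunct2, rule_format]
    \<comment> \<open>Since \<open>d\<close> is maximal in \<open>T\<close>, the factor \<open>u\<close> changes only the coefficient at \<open>d\<close>.\<close>
    define a' where "a' = a(d := P d - f d)"
    define u where "u = (\<lambda>k. if k = 0 then 1 else if k = d then - (a' d) else 0)"
    note uP = linear_factor_mult[OF d P(1) u_def]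
    have "P (- d) = 0" using d K_pointed P(1) by (auto simp: carrier_iff)
    then have "(u \<otimes>\<^bsub>R\<^esub> P) 0 = 1" by (simp add: uP P)
    moreover have "(u \<otimes>\<^bsub>R\<^esub> P) k = f k" if "k \<in> T" for k
    proof (cases "k = d")
      case True
      then show ?thesis by (simp add: uP P a'_def)
    next
      case False
      then have "k - d \<notin> K" using down that d T' by (force simp: below_def)
      then show ?thesis using Pf P(1) that False T' by (simp add: uP carrier_iff)
    qed
    moreover have "agree N (theta i (u \<otimes>\<^bsub>R\<^esub> P))
        ((u \<otimes>\<^bsub>R\<^esub> P) \<otimes>\<^bsub>R\<^esub> lpoly (T \<times> {1..L}) (dlog_term i a') exponent)"
      if L: "\<forall>d\<in>T. N - of_nat (Suc L) *s d \<notin> K" for i N L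
    proof -
      let ?G = "\<lambda>T. lpoly (T \<times> {1..L}) (dlog_term i a') exponent"
      have "?G S \<in> carrier R" if "S \<subseteq> K" for S
        using that by (intro lpoly_closed) (rule exponent_in_K)
      then have Gc: "?G {d} \<in> carrier R" "?G T' \<in> carrier R" using d T'(2) by auto
      have "?G T' = lpoly (T' \<times> {1..L}) (dlog_term i a) exponent"
        unfolding lpoly_def by (intro ext sum.cong) (use T' in \<open>auto simp: dlog_term_def a'_def\<close>)
      then have G': "agree N (theta i P) (P \<otimes>\<^bsub>R\<^esub> ?G T')"
        using theta_P L T' by auto
      have GT: "?G T = ?G {d} \<oplus>\<^bsub>R\<^esub> ?G T'"
        unfolding T'(3) using T' psubset.hyps(1)
        by (subst Sigma_Un_distrib1, intro ext, subst add_coeff, unfold lpoly_def)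
          (rule sum.union_disjoint, auto)
      \<comment> \<open>By the product rule this is the derivative of the new product; the factor
        \<open>u\<close> contributes the terms for \<open>d\<close>, and \<open>P\<close> those for
        \<open>T'\<close>.\<close>
      have "agree N (theta i u \<otimes>\<^bsub>R\<^esub> P \<oplus>\<^bsub>R\<^esub> u \<otimes>\<^bsub>R\<^esub> theta i P)
          ((u \<otimes>\<^bsub>R\<^esub> ?G {d}) \<otimes>\<^bsub>R\<^esub> P \<oplus>\<^bsub>R\<^esub> u \<otimes>\<^bsub>R\<^esub> (P \<otimes>\<^bsub>R\<^esub> ?G T'))"
        using theta_linear_factor[where a = a', OF d _ u_def] L dT G' uP(1) P Gc
        by (intro agree_add agree_mult) auto
      also have "(u \<otimes>\<^bsub>R\<^esub> ?G {d}) \<otimes>\<^bsub>R\<^esub> P \<oplus>\<^bsub>R\<^esub> u \<otimes>\<^bsub>R\<^esub> (P \<otimes>\<^bsub>R\<^esub> ?G T') = (u \<otimes>\<^bsub>R\<^esub> P) \<otimes>\<^bsub>R\<^esub> ?G T"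
        using uP(1) P Gc unfolding GT
        by (simp add: R.r_distr R.m_ac)
      finally show ?thesis using uP(1) P by (simp add: theta_mult)
    qed
    ultimately show ?thesis using uP(1) P by (intro exI[of _ a'] exI[of _ "u \<otimes>\<^bsub>R\<^esub> P"]) auto
  qed
qed

text \<open>Otherwise the \<open>l + 1\<close> distinct multiples of \<open>d\<close> from 0 to
  \<open>l\<close> would all lie in \<open>below N\<close>. This gives one truncation bound valid
  for all \<open>d\<close>.\<close>

lemma scale_not_below:
  assumes "d \<in> K" "d \<noteq> 0" "card (below N) \<le> l"
  shows "N - of_nat l *s d \<notin> K"
proof
  assume l: "N - of_nat l *s d \<in> K"
  have "inj_on (\<lambda>i::nat. of_nat i *s d) {..l}"
    using assms(2) by (auto simp: inj_on_def vec_eq_iff)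
  moreover have "(\<lambda>i::nat. of_nat i *s d) ` {..l} \<subseteq> below N"
  proof (safe)
    fix i assume i: "i \<le> l"
    have "N - of_nat i *s d = (N - of_nat l *s d) + of_nat (l - i) *s d"
      using i by (simp add: of_nat_diff vec_eq_iff algebra_simps)
    then have "N - of_nat i *s d \<in> K"
      using add_in_K[OF l nat_scale_in_K[OF assms(1), of "l - i"]] by metis
    then show "of_nat i *s d \<in> below N"
      using nat_scale_in_K[OF assms(1)] by (simp add: below_def)
  qed
  ultimately have "card {..l} \<le> card (below N)"
    by (intro card_inj_on_le) auto
  then show False using assms(3) by simp
qed

text \<open>With \<open>T\<close> all nonzero exponents of \<open>below N\<close>, the product
  \<open>P\<close> agrees with \<open>f\<close> wherever \<open>N\<close> can see it. One
  \<open>a\<close> serves all \<open>i\<close> and \<open>L\<close>, so different truncations can be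
  compared.\<close>

lemma log_derivative:
  fixes f :: "('a::comm_ring_1, 'n) laurent"
  assumes f: "f \<in> carrier R" "f 0 = 1"
  shows "\<exists>a. \<forall>i L. card (below N) \<le> L \<longrightarrow> agree N (theta i f \<otimes>\<^bsub>R\<^esub> inv\<^bsub>R\<^esub> f)
    (lpoly ((below N - {0}) \<times> {1..L}) (dlog_term i a) exponent)"
proof -
  let ?T = "below N - {0}"
  have down: "\<forall>k\<in>?T. below k \<subseteq> insert 0 ?T"
    using below_trans[of N] by (auto simp: below_def)
  have "finite ?T" "?T \<subseteq> K - {0}" by (simp, auto simp: below_def)
  from truncated_euler_product[OF f(1) this down]
  obtain a P where P: "P \<in> carrier R" "P 0 = 1" "\<forall>k\<in>?T. P k = f k"
    and theta_P: "\<forall>i M L. (\<forall>d\<in>?T. M - of_nat (Suc L) *s d \<notin> K) \<longrightarrow>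
      agree M (theta i P) (P \<otimes>\<^bsub>R\<^esub> lpoly (?T \<times> {1..L}) (dlog_term i a) exponent)"
    by (elim exE conjE)
  have fP: "agree N f P"
    unfolding agree_def
  proof (intro allI impI)
    fix k assume "N - k \<in> K"
    then show "f k = P k"
      using P f by (cases "k \<in> K"; cases "k = 0") (auto simp: carrier_iff below_def)
  qed
  have unit: "f \<in> Units R" using f by (rule unit_if_constant_coeff_1)
  have "agree N (theta i f \<otimes>\<^bsub>R\<^esub> inv\<^bsub>R\<^esub> f) (lpoly (?T \<times> {1..L}) (dlog_term i a) exponent)"
    if L: "card (below N) \<le> L" for i L
  proof -
    let ?G = "lpoly (?T \<times> {1..L}) (dlog_term i a) exponent"
    have Gc: "?G \<in> carrier R"
      by (rule lpoly_closed, erule exponent_in_K[rotated]) (auto simp: below_def)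
    have "agree N (theta i f) (theta i P)" using fP by (rule agree_theta)
    also have "agree N (theta i P) (P \<otimes>\<^bsub>R\<^esub> ?G)"
    proof (rule theta_P[rule_format])
      fix d assume "d \<in> ?T"
      then show "N - of_nat (Suc L) *s d \<notin> K"
        using L by (intro scale_not_below) (auto simp: below_def)
    qed
    also have "agree N (P \<otimes>\<^bsub>R\<^esub> ?G) (f \<otimes>\<^bsub>R\<^esub> ?G)"
      using P f Gc agree_sym[OF fP] by (intro agree_mult) auto
    finally have "agree N (theta i f \<otimes>\<^bsub>R\<^esub> inv\<^bsub>R\<^esub> f) ((f \<otimes>\<^bsub>R\<^esub> ?G) \<otimes>\<^bsub>R\<^esub> inv\<^bsub>R\<^esub> f)"
      using f Gc unit by (intro agree_mult) auto
    also have "(f \<otimes>\<^bsub>R\<^esub> ?G) \<otimes>\<^bsub>R\<^esub> inv\<^bsub>R\<^esub> f = ?G"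
      using f Gc unit by (metis R.Units_inv_closed R.Units_r_inv R.l_one R.m_assoc R.m_comm)
    finally show ?thesis .
  qed
  then show ?thesis by blast
qed


section \<open>Coefficients of the determinant\<close>

lemma ring_det_closed:
  assumes "\<And>i j. i \<in> {1..m} \<Longrightarrow> j \<in> {1..m} \<Longrightarrow> M i j \<in> carrier R"
  shows "ring_det R m M \<in> carrier R"
  unfolding ring_det_def
  using assms permutes_in_image[of _ "{1..m}"]
  by (intro R.finsum_closed Pi_I R.add.int_pow_closed R.finprod_closed) auto

lemma ring_det_coeff:
  assumes "\<And>i j. i \<in> {1..m} \<Longrightarrow> j \<in> {1..m} \<Longrightarrow> M i j \<in> carrier R"
  shows "ring_det R m M k
    = (\<Sum>\<sigma> | \<sigma> permutes {1..m}. of_int (sign \<sigma>) * finprod R (\<lambda>i. M i (\<sigma> i)) {1..m} k)"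
proof -
  have c: "finprod R (\<lambda>i. M i (\<sigma> i)) {1..m} \<in> carrier R" if "\<sigma> permutes {1..m}" for \<sigma>
    using assms that permutes_in_image[OF that] by (auto intro!: R.finprod_closed)
  then have "[sign \<sigma>] \<cdot>\<^bsub>R\<^esub> finprod R (\<lambda>i. M i (\<sigma> i)) {1..m} \<in> carrier R" if "\<sigma> permutes {1..m}" for \<sigma>
    using that by (simp add: R.add.int_pow_closed)
  then show ?thesis unfolding ring_det_def
    using c by (subst finsum_coeff) (auto simp: finite_permutations add_pow_int_coeff)
qed

text \<open>A family \<open>w\<close> picks one pair (d, l) for each column. The weight and the
  powers of \<open>a\<close> then do not depend on the permutation, and the signed sum of coordinate
  products is an integer determinant. The same \<open>a\<close> works for every \<open>k\<close>
  preceding \<open>N\<close>.\<close>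

lemma ring_det_log_derivatives_coeff:
  fixes f :: "nat \<Rightarrow> ('a::comm_ring_1, 'n) laurent" and var :: "nat \<Rightarrow> 'n"
  assumes f: "\<And>j. j \<in> {1..m} \<Longrightarrow> f j \<in> carrier R" "\<And>j. j \<in> {1..m} \<Longrightarrow> f j 0 = 1"
  shows "\<exists>a. \<forall>L\<ge>card (below N). \<forall>k. N - k \<in> K \<longrightarrow>
    ring_det R m (\<lambda>i j. theta (var i) (f j) \<otimes>\<^bsub>R\<^esub> inv\<^bsub>R\<^esub> (f j)) k
    = (\<Sum>w\<in>PiE {1..m} (\<lambda>_. (below N - {0}) \<times> {1..L}).
        if (\<Sum>j\<in>{1..m}. exponent (w j)) = k
        then of_int (leibniz_det {1..m} (\<lambda>i j. fst (w j) $ var i)) *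
          (\<Prod>j\<in>{1..m}. - (a j (fst (w j)) ^ snd (w j)))
        else 0)"
proof -
  let ?I = "{1..m}" and ?M = "\<lambda>i j. theta (var i) (f j) \<otimes>\<^bsub>R\<^esub> inv\<^bsub>R\<^esub> (f j)"
  have "\<forall>j\<in>?I. \<exists>a. \<forall>i L. card (below N) \<le> L \<longrightarrow> agree N (theta i (f j) \<otimes>\<^bsub>R\<^esub> inv\<^bsub>R\<^esub> (f j))
      (lpoly ((below N - {0}) \<times> {1..L}) (dlog_term i a) exponent)"
    using log_derivative f by blast
  then obtain a where a: "\<And>j i L. j \<in> ?I \<Longrightarrow> card (below N) \<le> L \<Longrightarrow>
      agree N (theta i (f j) \<otimes>\<^bsub>R\<^esub> inv\<^bsub>R\<^esub> (f j))
        (lpoly ((below N - {0}) \<times> {1..L}) (dlog_term i (a j)) exponent)"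
    by (metis (no_types))
  have Mc: "?M i j \<in> carrier R" if "j \<in> ?I" for i j
    using f that by (auto intro!: R.m_closed R.Units_inv_closed unit_if_constant_coeff_1)
  have "ring_det R m ?M k = (\<Sum>w\<in>PiE ?I (\<lambda>_. (below N - {0}) \<times> {1..L}).
        if (\<Sum>j\<in>?I. exponent (w j)) = k
        then of_int (leibniz_det ?I (\<lambda>i j. fst (w j) $ var i)) *
          (\<Prod>j\<in>?I. - (a j (fst (w j)) ^ snd (w j)))
        else 0)" if L: "card (below N) \<le> L" and k: "N - k \<in> K" for L k
  proof -
    let ?Q = "(below N - {0}) \<times> {1..L}"
    let ?W = "PiE ?I (\<lambda>_. ?Q)"
    let ?G = "\<lambda>i j. lpoly ?Q (dlog_term (var i) (a j)) exponent"
    have e: "exponent q \<in> K" if "q \<in> ?Q" for q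
      by (rule exponent_in_K[OF _ that]) (auto simp: below_def)
    have fp: "finprod R (\<lambda>i. ?M i (\<sigma> i)) ?I k = (\<Sum>w\<in>?W. if (\<Sum>j\<in>?I. exponent (w j)) = k
        then (\<Prod>i\<in>?I. of_int (fst (w (\<sigma> i)) $ var i)) * (\<Prod>j\<in>?I. - (a j (fst (w j)) ^ snd (w j)))
        else 0)" if \<sigma>: "\<sigma> permutes ?I" for \<sigma>
    proof -
      have "agree N (finprod R (\<lambda>i. ?M i (\<sigma> i)) ?I) (finprod R (\<lambda>i. ?G i (\<sigma> i)) ?I)"
        using permutes_in_image[OF \<sigma>] Mc a L lpoly_closed[of ?Q exponent, OF e]
        by (intro agree_finprod) auto
      then have "finprod R (\<lambda>i. ?M i (\<sigma> i)) ?I k = finprod R (\<lambda>i. ?G i (\<sigma> i)) ?I k"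
        using k by (simp add: agree_def)
      also have "\<dots> = (\<Sum>w\<in>?W. if (\<Sum>i\<in>?I. exponent (w i)) = k
          then \<Prod>i\<in>?I. dlog_term (var i) (a (\<sigma> i)) (w i) else 0)"
        by (subst finprod_lpoly[OF _ e]) (simp_all add: lpoly_def cong: if_cong)
      \<comment> \<open>The expansion indexes \<open>w\<close> by rows; composing with
        \<open>\<sigma>\<close> indexes it by columns, to which the functions \<open>a j\<close>
        belong.\<close>
      also have "\<dots> = (\<Sum>w\<in>?W. if (\<Sum>i\<in>?I. exponent (w (\<sigma> i))) = k
          then \<Prod>i\<in>?I. dlog_term (var i) (a (\<sigma> i)) (w (\<sigma> i)) else 0)"
      proof (rule sum.reindex_bij_witness[of _ "\<lambda>w. w \<circ> \<sigma>" "\<lambda>w. w \<circ> inv_into UNIV \<sigma>"])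
        have comp: "w \<circ> \<tau> \<in> ?W" if "w \<in> ?W" "\<tau> permutes ?I" for w \<tau>
          unfolding PiE_iff extensional_def
        proof (intro conjI ballI CollectI allI impI)
          fix i assume "i \<in> ?I"
          then show "(w \<circ> \<tau>) i \<in> ?Q" using that permutes_in_image[OF that(2)] by (auto simp: PiE_iff)
        next
          fix i assume "i \<notin> ?I"
          then show "(w \<circ> \<tau>) i = undefined"
            using that permutes_not_in[OF that(2)] by (auto simp: PiE_iff extensional_def)
        qed
        fix w assume w: "w \<in> ?W"
        show "w \<circ> \<sigma> \<in> ?W" "w \<circ> inv_into UNIV \<sigma> \<in> ?W"
          using comp[OF w \<sigma>] comp[OF w permutes_inv[OF \<sigma>]] by blast+
      qed (use permutes_inverses[OF \<sigma>] in \<open>auto simp: fun_eq_iff\<close>)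
      also have "\<dots> = (\<Sum>w\<in>?W. if (\<Sum>j\<in>?I. exponent (w j)) = k
          then (\<Prod>i\<in>?I. of_int (fst (w (\<sigma> i)) $ var i)) * (\<Prod>j\<in>?I. - (a j (fst (w j)) ^ snd (w j)))
          else 0)"
      proof (intro sum.cong refl)
        fix w
        have "(\<Sum>i\<in>?I. exponent (w (\<sigma> i))) = (\<Sum>j\<in>?I. exponent (w j))"
          using sum.permute[OF \<sigma>, of "\<lambda>j. exponent (w j)"] by (simp add: comp_def)
        moreover have "(\<Prod>i\<in>?I. - (a (\<sigma> i) (fst (w (\<sigma> i))) ^ snd (w (\<sigma> i))))
            = (\<Prod>j\<in>?I. - (a j (fst (w j)) ^ snd (w j)))"
          using prod.permute[OF \<sigma>, of "\<lambda>j. - (a j (fst (w j)) ^ snd (w j))"] by (simp add: comp_def)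
        ultimately show "(if (\<Sum>i\<in>?I. exponent (w (\<sigma> i))) = k
            then \<Prod>i\<in>?I. dlog_term (var i) (a (\<sigma> i)) (w (\<sigma> i)) else 0)
          = (if (\<Sum>j\<in>?I. exponent (w j)) = k
            then (\<Prod>i\<in>?I. of_int (fst (w (\<sigma> i)) $ var i)) * (\<Prod>j\<in>?I. - (a j (fst (w j)) ^ snd (w j)))
            else 0)"
          by (simp add: dlog_term_def split_def prod.distrib del: mult_minus_right)
      qed
      finally show ?thesis .
    qed
    have "ring_det R m ?M k = (\<Sum>\<sigma> | \<sigma> permutes ?I. of_int (sign \<sigma>) * finprod R (\<lambda>i. ?M i (\<sigma> i)) ?I k)"
      by (rule ring_det_coeff) (rule Mc)
    also have "\<dots> = (\<Sum>\<sigma> | \<sigma> permutes ?I. \<Sum>w\<in>?W. of_int (sign \<sigma>) *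
        (if (\<Sum>j\<in>?I. exponent (w j)) = k
        then (\<Prod>i\<in>?I. of_int (fst (w (\<sigma> i)) $ var i)) * (\<Prod>j\<in>?I. - (a j (fst (w j)) ^ snd (w j)))
        else 0))"
      by (intro sum.cong refl) (simp only: fp mem_Collect_eq sum_distrib_left)
    also have "\<dots> = (\<Sum>w\<in>?W. if (\<Sum>j\<in>?I. exponent (w j)) = k
        then of_int (leibniz_det ?I (\<lambda>i j. fst (w j) $ var i)) *
          (\<Prod>j\<in>?I. - (a j (fst (w j)) ^ snd (w j)))
        else 0)"
      by (subst sum.swap) (auto simp: leibniz_det_def sum_distrib_right mult.assoc intro!: sum.cong)
    finally show ?thesis .
  qed
  then show ?thesis by blast
qed

end

section \<open>Matching the terms at \<open>N\<close> with those at \<open>N / p\<close>\<close>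

theorem theorem4p4:
  fixes p m :: nat
    and \<phi> :: "'a::{idom,ring_char_0} \<Rightarrow> 'a"
    and var :: "nat \<Rightarrow> 'n::finite"
    and S C :: "(real ^ 'n) set"
    and f :: "nat \<Rightarrow> ('a, 'n) laurent"
    and F :: "('a, 'n) laurent"
  assumes "prime p"
    and "frobenius_lift p \<phi>"
    and "bij_betw var {1..CARD('n)} UNIV"
    and "m \<le> CARD('n)"
    and "C = convex_cone hull S"
    and "proper_cone C"
    and "finite_decompositions C"
    and "\<And>j. j \<in> {1..m} \<Longrightarrow> f j 0 = 1"
    and "\<And>j. j \<in> {1..m} \<Longrightarrow> real_vec ` supp (f j) \<subseteq> C"
    and "F = ring_det (cone_series C) m
               (\<lambda>i j. theta (var i) (f j) \<otimes>\<^bsub>cone_series C\<^esub> inv\<^bsub>cone_series C\<^esub> (f j))"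
  shows "gauss_congruences p \<phi> F"
proof -
  note p = assms(1)
  have C_add: "x \<in> C \<Longrightarrow> y \<in> C \<Longrightarrow> x + y \<in> C" and C_0: "0 \<in> C"
    and C_scale: "x \<in> C \<Longrightarrow> 0 \<le> c \<Longrightarrow> c *\<^sub>R x \<in> C" for x y c
    using convex_cone_convex_cone_hull[of S] unfolding assms(5) convex_cone_iff by blast+
  obtain \<alpha> where \<alpha>: "linear \<alpha>" "\<And>w. w \<in> C \<Longrightarrow> w \<noteq> 0 \<Longrightarrow> \<alpha> w > (0::real)"
    using assms(6) unfolding proper_cone_def by blast
  \<comment> \<open>A linear form cannot be positive on both \<open>x\<close> and
    \<open>- x\<close>.\<close>
  interpret pointed_cone C
  proof
    show "x = 0" if "x \<in> C" "- x \<in> C" for x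
      using \<alpha>(2)[OF that(1)] \<alpha>(2)[OF that(2)] linear_neg[OF \<alpha>(1), of x] by fastforce
  qed (use C_0 C_add assms(7) in auto)
  have \<phi>: "ring_endo \<phi>" and "of_nat p dvd \<phi> a - a ^ p" for a
    using assms(2) by (auto simp: frobenius_lift_def)
  then have frob: "of_nat p dvd a ^ p - \<phi> a" for a
    using dvd_minus_iff[of "of_nat p" "\<phi> a - a ^ p"] by simp
  let ?I = "{1..m}" and ?A = "\<lambda>w i j. fst (w j) $ var i"
  have fc: "f j \<in> carrier R" if "j \<in> ?I" for j
    using assms(9)[OF that] by (simp add: cone_series_def)
  have F_outside: "F k = 0" if "k \<notin> K" for k
  proof -
    have "F \<in> carrier R"
      unfolding assms(10) using fc assms(8)
      by (intro ring_det_closed R.m_closed theta_closed R.Units_inv_closed unit_if_constant_coeff_1)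
    then show ?thesis using that by (simp add: carrier_iff)
  qed
  \<comment> \<open>Real scaling of the cone allows division by \<open>q\<close>, so
    \<open>N\<close> and \<open>N'\<close> lie in \<open>K\<close> together; outside
    \<open>K\<close> both coefficients vanish.\<close>
  have scale_iff: "of_nat q *s k \<in> K \<longleftrightarrow> k \<in> K" if "q > 0" for q k
  proof
    assume "of_nat q *s k \<in> K"
    moreover have "real_vec k = (1 / real q) *\<^sub>R real_vec (of_nat q *s k)"
      using that by (simp add: real_vec_def vec_eq_iff)
    ultimately show "k \<in> K" using C_scale[of _ "1 / real q"] by (simp add: K_def)
  qed (rule nat_scale_in_K)
  have p0: "p > 0" using p by (rule prime_gt_0_nat)
  show ?thesis
    unfolding gauss_congruences_def
  proof (intro allI impI)
    fix v :: "int ^ 'n" and r :: nat assume "r \<ge> 1"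
    then obtain t where r: "r = Suc t" by (cases r) auto
    define N' where "N' = of_nat (p ^ t) *s v"
    define N where "N = of_nat (p ^ r) *s v"
    have N: "N = of_nat p *s N'" by (simp add: N_def N'_def r vec_eq_iff)
    have "of_nat p ^ r dvd F N - \<phi> (F N')"
    proof (cases "N' \<in> K")
      case False
      then have "N \<notin> K" using scale_iff p0 N by simp
      then show ?thesis using False by (simp add: F_outside ring_endo_0[OF \<phi>])
    next
      case True
      have "N - N' = of_nat (p - 1) *s N'"
        using p0 by (simp add: N vec_eq_iff of_nat_diff algebra_simps)
      \<comment> \<open>As \<open>N'\<close> precedes \<open>N\<close>, the expansion prepared for
        \<open>N\<close> also computes the coefficient at \<open>N'\<close>, with the same
        \<open>a\<close>.\<close>
      then have NN': "N - N' \<in> K" using nat_scale_in_K[OF True] by metis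
      define L where "L = card (below N)"
      define W where "W L = PiE ?I (\<lambda>_. (below N - {0}) \<times> {1..L})" for L :: nat
      have finW: "finite (W L)" for L unfolding W_def by (intro finite_PiE) auto
      let ?wt = "\<lambda>w. \<Sum>j\<in>?I. exponent (w j)"
      have "\<exists>a. \<forall>L\<ge>card (below N). \<forall>k. N - k \<in> K \<longrightarrow> F k = (\<Sum>w\<in>W L.
          if ?wt w = k
          then of_int (leibniz_det ?I (?A w)) * (\<Prod>j\<in>?I. - (a j (fst (w j)) ^ snd (w j)))
          else 0)" (is "\<exists>a. ?coeffs a")
        unfolding assms(10) W_def
        by (rule ring_det_log_derivatives_coeff) (use fc assms(8) in blast)+
      then obtain a where a: "?coeffs a" ..
      let ?h = "\<lambda>w. if ?wt w = N then of_int (leibniz_det ?I (?A w)) * (\<Prod>j\<in>?I. - (a j (fst (w j)) ^ snd (w j))) else 0"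
      \<comment> \<open>The matching multiplies every \<open>l\<close> by \<open>p\<close> and keeps
        every \<open>d\<close>. Truncating at \<open>p * L\<close> for \<open>N\<close> and at
        \<open>L\<close> for \<open>N'\<close> makes its image fit exactly.\<close>
      define \<iota> where "\<iota> w = (\<lambda>j\<in>?I. (fst (w j), p * snd (w j)))" for w :: "nat \<Rightarrow> (int ^ 'n) \<times> nat"
      have "L \<le> p * L" using p0 by simp
      then have FN: "F N = sum ?h (W (p * L))"
        using a by (simp add: L_def)
      have FN': "F N' = (\<Sum>w\<in>W L. if ?wt w = N'
          then of_int (leibniz_det ?I (?A w)) * (\<Prod>j\<in>?I. - (a j (fst (w j)) ^ snd (w j))) else 0)"
        using a NN' by (simp add: L_def)
      \<comment> \<open>The determinants are integers, which \<open>\<phi>\<close> fixes; only the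
        values of \<open>a\<close> change.\<close>
      have \<phi>FN': "\<phi> (F N') = (\<Sum>w\<in>W L. if ?wt w = N'
          then of_int (leibniz_det ?I (?A w)) * (\<Prod>j\<in>?I. - (\<phi> (a j (fst (w j))) ^ snd (w j))) else 0)"
        using \<phi> unfolding FN' ring_endo_sum[OF \<phi>]
        by (intro sum.cong refl)
          (auto simp: ring_endo_0 ring_endo_of_int ring_endo_prod ring_endo_uminus ring_endo_power ring_endo_def)
      have \<iota>_W: "\<iota> ` W L \<subseteq> W (p * L)"
      proof (rule image_subsetI)
        fix w assume w: "w \<in> W L"
        show "\<iota> w \<in> W (p * L)"
          unfolding W_def
        proof (rule PiE_I)
          fix j assume j: "j \<in> ?I"
          then have "w j \<in> (below N - {0}) \<times> {1..L}" using w unfolding W_def by (rule PiE_mem[rotated])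
          then show "\<iota> w j \<in> (below N - {0}) \<times> {1..p * L}"
            using j p0 by (auto simp: \<iota>_def mem_Times_iff)
        qed (auto simp: \<iota>_def)
      qed
      have inj: "inj_on \<iota> (W L)"
      proof (rule inj_onI)
        fix w w' assume w: "w \<in> W L" "w' \<in> W L" and eq: "\<iota> w = \<iota> w'"
        show "w = w'"
        proof (rule PiE_ext)
          show "w \<in> PiE ?I (\<lambda>_. (below N - {0}) \<times> {1..L})" "w' \<in> PiE ?I (\<lambda>_. (below N - {0}) \<times> {1..L})"
            using w by (auto simp: W_def)
          fix j assume "j \<in> ?I"
          then show "w j = w' j" using fun_cong[OF eq, of j] p0 by (simp add: \<iota>_def prod_eq_iff)
        qed
      qed
      have wt_\<iota>: "?wt (\<iota> w) = of_nat p *s ?wt w" for w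
        by (simp add: \<iota>_def exponent_def split_def vec_eq_iff sum_distrib_left mult.assoc)
      \<comment> \<open>Read in coordinate \<open>var i\<close>, the weight condition is the linear
        system needed for Cramer's rule.\<close>
      have dvd_entries: "int p ^ r dvd (\<Sum>j\<in>?I. ?A w i j * int (snd (w j)))" if "?wt w = N" for w i
      proof -
        have "(\<Sum>j\<in>?I. ?A w i j * int (snd (w j))) = ?wt w $ var i"
          by (simp add: exponent_def split_def mult.commute)
        then show ?thesis unfolding that by (simp add: N_def)
      qed
      \<comment> \<open>If \<open>p\<close> divided all \<open>l\<close>, division by
        \<open>p\<close> would give a preimage under \<open>\<iota>\<close>. So some
        \<open>l\<close> is prime to \<open>p\<close>, and the determinant alone is divisible by
        \<open>p ^ r\<close>.\<close>
      have rest: "of_nat p ^ r dvd ?h w" if w: "w \<in> W (p * L)" "w \<notin> \<iota> ` W L" for w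
      proof -
        have "\<exists>j\<in>?I. \<not> p dvd snd (w j)"
        proof (rule ccontr)
          assume "\<not> (\<exists>j\<in>?I. \<not> p dvd snd (w j))"
          then have dvd: "p dvd snd (w j)" if "j \<in> ?I" for j using that by blast
          define w' where "w' = (\<lambda>j\<in>?I. (fst (w j), snd (w j) div p))"
          have "w' \<in> W L"
            unfolding W_def
          proof (rule PiE_I)
            fix j assume j: "j \<in> ?I"
            then have "fst (w j) \<in> below N - {0}" "snd (w j) \<in> {1..p * L}"
              using w(1) by (auto simp: W_def PiE_iff mem_Times_iff)
            moreover obtain q where "snd (w j) = p * q" using dvd[OF j] by (elim dvdE)
            ultimately show "w' j \<in> (below N - {0}) \<times> {1..L}"
              using j p0 by (auto simp: w'_def Suc_le_eq)
          qed (auto simp: w'_def)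
          moreover have "\<iota> w' = w"
          proof
            fix j show "\<iota> w' j = w j"
              using w(1) dvd[of j] by (cases "j \<in> ?I") (auto simp: \<iota>_def w'_def W_def PiE_iff extensional_def)
          qed
          ultimately show False using w(2) by blast
        qed
        then obtain j where j: "j \<in> ?I" "\<not> p dvd snd (w j)" by blast
        have "int p ^ r dvd leibniz_det ?I (?A w)" if "?wt w = N"
          using dvd_leibniz_det_if_not_dvd[OF p _ j(1), of 0 "\<lambda>j. snd (w j)" r "?A w"] j(2) dvd_entries[OF that]
          by simp
        then have "(of_int (int p ^ r) :: 'a) dvd of_int (leibniz_det ?I (?A w))" if "?wt w = N"
          using that of_int_dvd_of_int by blast
        then show ?thesis by simp
      qed
      \<comment> \<open>Since \<open>\<iota>\<close> multiplies the weight by \<open>p\<close>,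
        weight \<open>N'\<close> corresponds exactly to weight \<open>N\<close>. The determinants
        coincide, and the powers are compared through the Frobenius congruence.\<close>
      have lifted: "of_nat p ^ r dvd ?h (\<iota> w) - (if ?wt w = N'
          then of_int (leibniz_det ?I (?A w)) * (\<Prod>j\<in>?I. - (\<phi> (a j (fst (w j))) ^ snd (w j))) else 0)" for w
      proof (cases "?wt w = N'")
        case True
        then have wtN: "?wt (\<iota> w) = N" unfolding wt_\<iota> N by (rule arg_cong)
        have A: "leibniz_det ?I (?A (\<iota> w)) = leibniz_det ?I (?A w)"
          unfolding leibniz_det_def \<iota>_def
          by (intro sum.cong prod.cong arg_cong2[where f = "(*)"] refl) (auto dest: permutes_in_image)
        have prd: "(\<Prod>j\<in>?I. - (a j (fst (\<iota> w j)) ^ snd (\<iota> w j)))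
            = (\<Prod>j\<in>?I. - (a j (fst (w j)) ^ (p * snd (w j))))"
          by (simp add: \<iota>_def)
        have "of_nat p ^ r dvd of_int (leibniz_det ?I (?A w)) *
            ((\<Prod>j\<in>?I. - (a j (fst (w j)) ^ (p * snd (w j)))) - (\<Prod>j\<in>?I. - (\<phi> (a j (fst (w j))) ^ snd (w j))))"
        proof (rule dvd_det_times_power_diff[OF p])
          show "of_nat p dvd a j (fst (w j)) ^ p - \<phi> (a j (fst (w j)))" for j
            by (rule frob)
          show "int p ^ r dvd (\<Sum>j\<in>?I. ?A w i j * int (p * snd (w j)))" for i
            using dvd_entries[OF wtN, of i] by (simp add: \<iota>_def)
        qed simp
        then show ?thesis unfolding A prd if_P[OF True] if_P[OF wtN] right_diff_distrib .
      next
        case False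
        then have "?wt (\<iota> w) \<noteq> N" unfolding wt_\<iota> N using p0 by (auto simp: vec_eq_iff)
        then show ?thesis using False by simp
      qed
      \<comment> \<open>The families at \<open>N\<close> split into matched ones, reindexed by
        \<open>\<iota>\<close>, and unmatched ones.\<close>
      have "F N = sum ?h (W (p * L) - \<iota> ` W L) + (\<Sum>w\<in>W L. ?h (\<iota> w))"
        unfolding FN using sum.subset_diff[OF \<iota>_W finW, of ?h] sum.reindex[OF inj, of ?h] by (simp only: comp_def)
      then have "F N - \<phi> (F N') = sum ?h (W (p * L) - \<iota> ` W L) + (\<Sum>w\<in>W L. ?h (\<iota> w) - (if ?wt w = N'
          then of_int (leibniz_det ?I (?A w)) * (\<Prod>j\<in>?I. - (\<phi> (a j (fst (w j))) ^ snd (w j))) else 0))"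
        unfolding \<phi>FN' sum_subtractf by simp
      then show ?thesis
        using rest lifted by (simp only:) (intro dvd_add dvd_sum, auto)
    qed
    then show "of_nat p ^ r dvd F (of_nat (p ^ r) *s v) - \<phi> (F (of_nat (p ^ (r - 1)) *s v))"
      by (simp add: N_def N'_def r)
  qed
qed

end
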